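(* Let $X$ be an infinite-dimensional complex Banach space and $T\in L(X)$. Then $T$ belongs to the class $(B_e)$ if and only if $T$ belongs to the class $(gB_e)$; that is, $\sigma_e(T)=\sigma_b(T)$ if and only if $\sigma_{bf}(T)=\sigma_d(T)$.
   Context: $L(X)$ denotes the algebra of bounded linear operators on $X$. For $S\in L(X)$: $\mathcal N(S)$ is the kernel, $\mathcal R(S)$ the range, $\alpha(S)=\dim\mathcal N(S)$, $\beta(S)=\operatorname{codim}\mathcal R(S)$; the ascent is $p(S)=\inf\{n\in\mathbb N:\mathcal N(S^n)=\mathcal N(S^{n+1})\}$ and the descent is $q(S)=\inf\{n:\mathcal R(S^n)=\mathcal R(S^{n+1})\}$ (infimum of the empty set is $\infty$). $S$ is Fredholm if $\mathcal R(S)$ is closed and $\alpha(S),\beta(S)<\infty$; $S$ is Browder if it is Fredholm with finite ascent and descent. For $n\in\mathbb N$, $S_{[n]}$ denotes the restriction of $S$ to $\mathcal R(S^n)$; $S$ is B-Fredholm if for some $n$, $\mathcal R(S^n)$ is closed and $S_{[n]}:\mathcal R(S^n)\to\mathcal R(S^n)$ is Fredholm. The essential spectrum $\sigma_e(T)$, Browder spectrum $\sigma_b(T)$, and B-Fredholm spectrum $\sigma_{bf}(T)$ are the sets of $\lambda\in\mathbb C$ for which $T-\lambda I$ is not Fredholm, not Browder, not B-Fredholm, respectively. The Drazin spectrum is $\sigma_d(T)=\{\lambda\in\mathbb C: p(T-\lambda I)=\infty \text{ or } q(T-\lambda I)=\infty\}$. $\Pi(T)$ is the set of poles: $\lambda\in\sigma(T)$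 with $p(T-\lambda I),q(T-\lambda I)<\infty$; $\Pi^0(T)=\{\lambda\in\Pi(T):\alpha(T-\lambda I)<\infty\}$. $T\in(B_e)$ means $\sigma(T)\setminus\sigma_e(T)=\Pi^0(T)$, equivalently $\sigma_e(T)=\sigma_b(T)$; $T\in(gB_e)$ means $\sigma(T)\setminus\sigma_{bf}(T)=\Pi(T)$, equivalently $\sigma_{bf}(T)=\sigma_d(T)$. *)

theory Defs
  imports "HOL-Analysis.Analysis" "HOL-Library.Extended_Nat"
begin

class complex_vector_space = real_vector +
  fixes scaleC :: "complex \<Rightarrow> 'a \<Rightarrow> 'a"
  assumes scaleC_add_right: "scaleC a (x + y) = scaleC a x + scaleC a y"
    and scaleC_add_left: "scaleC (a + b) x = scaleC a x + scaleC b x"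
    and scaleC_scaleC: "scaleC a (scaleC b x) = scaleC (a * b) x"
    and scaleC_one: "scaleC 1 x = x"
    and scaleR_scaleC: "scaleR r x = scaleC (complex_of_real r) x"

class complex_normed_vector_space = complex_vector_space + real_normed_vector +
  assumes norm_scaleC: "norm (scaleC a x) = cmod a * norm x"

class complex_banach_space = complex_normed_vector_space + banach

definition cspan :: "'a::complex_vector_space set \<Rightarrow> 'a set" where
  "cspan S = module.span scaleC S"

definition fin_dim :: "'a::complex_vector_space set \<Rightarrow> bool" where
  "fin_dim M \<longleftrightarrow> (\<exists>B. finite B \<and> B \<subseteq> M \<and> cspan B = M)"

definition fin_codim_in :: "'a::complex_vector_space set \<Rightarrow> 'a set \<Rightarrow> bool" where
  "fin_codim_in M R \<longleftrightarrow> (\<exists>B. finite B \<and> B \<subseteq> M \<and> M \<subseteq> cspan (R \<union> B))"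

definition bounded_op :: "('a::complex_banach_space \<Rightarrow> 'a) \<Rightarrow> bool" where
  "bounded_op T \<longleftrightarrow> bounded_linear T \<and> (\<forall>c x. T (scaleC c x) = scaleC c (T x))"

definition kernel :: "('a::complex_vector_space \<Rightarrow> 'a) \<Rightarrow> 'a set" where
  "kernel S = {x. S x = 0}"

definition shift :: "('a::complex_vector_space \<Rightarrow> 'a) \<Rightarrow> complex \<Rightarrow> 'a \<Rightarrow> 'a" where
  "shift T z = (\<lambda>x. T x - scaleC z x)"

definition ascent :: "('a::complex_vector_space \<Rightarrow> 'a) \<Rightarrow> enat" where
  "ascent S = (if \<exists>n. kernel (S ^^ n) = kernel (S ^^ Suc n)
               then enat (LEAST n. kernel (S ^^ n) = kernel (S ^^ Suc n)) else \<infinity>)"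

definition descent :: "('a::complex_vector_space \<Rightarrow> 'a) \<Rightarrow> enat" where
  "descent S = (if \<exists>n. range (S ^^ n) = range (S ^^ Suc n)
               then enat (LEAST n. range (S ^^ n) = range (S ^^ Suc n)) else \<infinity>)"

text \<open>Fredholmness of \<open>S\<close> regarded as an operator on the (closed, invariant) subspace \<open>M\<close>:
  range \<open>S(M)\<close> closed in \<open>M\<close>, kernel \<open>N(S) \<inter> M\<close> finite-dimensional,
  range of finite codimension in \<open>M\<close>.\<close>
definition fredholm_on :: "'a::complex_banach_space set \<Rightarrow> ('a \<Rightarrow> 'a) \<Rightarrow> bool" where
  "fredholm_on M S \<longleftrightarrow> closedin (top_of_set M) (S ` M) \<and> fin_dim (kernel S \<inter> M)
     \<and> fin_codim_in M (S ` M)"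

definition fredholm :: "('a::complex_banach_space \<Rightarrow> 'a) \<Rightarrow> bool" where
  "fredholm S \<longleftrightarrow> fredholm_on UNIV S"

definition browder :: "('a::complex_banach_space \<Rightarrow> 'a) \<Rightarrow> bool" where
  "browder S \<longleftrightarrow> fredholm S \<and> ascent S < \<infinity> \<and> descent S < \<infinity>"

definition b_fredholm :: "('a::complex_banach_space \<Rightarrow> 'a) \<Rightarrow> bool" where
  "b_fredholm S \<longleftrightarrow> (\<exists>n. closed (range (S ^^ n)) \<and> fredholm_on (range (S ^^ n)) S)"

definition invertible_op :: "('a::complex_banach_space \<Rightarrow> 'a) \<Rightarrow> bool" where
  "invertible_op S \<longleftrightarrow> (\<exists>R. bounded_op R \<and> R \<circ> S = id \<and> S \<circ> R = id)"

definition spec :: "('a::complex_banach_space \<Rightarrow> 'a) \<Rightarrow> complex set" where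
  "spec T = {z. \<not> invertible_op (shift T z)}"

definition spec_e :: "('a::complex_banach_space \<Rightarrow> 'a) \<Rightarrow> complex set" where
  "spec_e T = {z. \<not> fredholm (shift T z)}"

definition spec_b :: "('a::complex_banach_space \<Rightarrow> 'a) \<Rightarrow> complex set" where
  "spec_b T = {z. \<not> browder (shift T z)}"

definition spec_bf :: "('a::complex_banach_space \<Rightarrow> 'a) \<Rightarrow> complex set" where
  "spec_bf T = {z. \<not> b_fredholm (shift T z)}"

definition spec_d :: "('a::complex_banach_space \<Rightarrow> 'a) \<Rightarrow> complex set" where
  "spec_d T = {z. ascent (shift T z) = \<infinity> \<or> descent (shift T z) = \<infinity>}"

definition poles :: "('a::complex_banach_space \<Rightarrow> 'a) \<Rightarrow> complex set" where
  "poles T = {z\<in>spec T. ascent (shift T z) < \<infinity> \<and> descent (shift T z) < \<infinity>}"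

definition poles0 :: "('a::complex_banach_space \<Rightarrow> 'a) \<Rightarrow> complex set" where
  "poles0 T = {z\<in>poles T. fin_dim (kernel (shift T z))}"

definition class_Be :: "('a::complex_banach_space \<Rightarrow> 'a) \<Rightarrow> bool" where
  "class_Be T \<longleftrightarrow> spec T - spec_e T = poles0 T"

definition class_gBe :: "('a::complex_banach_space \<Rightarrow> 'a) \<Rightarrow> bool" where
  "class_gBe T \<longleftrightarrow> spec T - spec_bf T = poles T"

end

theory Submission
  imports Defs
begin

text \<open>
  Both equivalences reduce to one implication: if every Fredholm \<open>T - z\<close> has finite ascent and descent,
  then so does every B-Fredholm \<open>T - z\<close>. Take \<open>z = 0\<close> and write \<open>M\<^sub>k\<close> for the range of \<open>T\<^sup>k\<close>.
  For small \<open>\<mu> \<noteq> 0\<close> the operator \<open>T - \<mu>\<close> is Fredholm, because its kernel lies in every \<open>M\<^sub>k\<close> and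
  each \<open>M\<^sub>k\<close> together with its range spans the space; so \<open>T - \<mu>\<close> has finite ascent and descent.

  Ascent: \<open>T\<close> maps the closed subspace \<open>Y = \<Inter>\<^sub>k M\<^sub>k\<close> onto itself. A nonzero kernel vector of \<open>T\<close> in \<open>Y\<close>
  would persist for \<open>T - \<mu>\<close>, which is still onto on \<open>Y\<close> by the open mapping theorem, and an operator that
  is onto but not injective on \<open>Y\<close> has infinite ascent. Hence the kernel of \<open>T\<close> meets some \<open>M\<^sub>k\<close> trivially.

  Descent: on such an \<open>M\<^sub>k\<close>, \<open>T - \<mu>\<close> is bounded below uniformly in \<open>\<mu>\<close>, so it is injective and, having
  finite descent, onto. The solutions of \<open>(T - \<mu>) x = y\<close> then stay bounded as \<open>\<mu>\<close> tends to \<open>0\<close>, so \<open>y\<close> is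
  in the closure of \<open>T M\<^sub>k\<close>, which is closed.
\<close>

section \<open>Open mapping theorem on closed subspaces\<close>

text \<open>Correct the error repeatedly: solving approximately for what remains halves it each
  time, and the corrections are dominated by a geometric series whose sum gives the factor 2. The
  domain is complete and \<open>D\<close> is closed, so the series converges in
  \<open>D\<close>.\<close>

lemma approx_surj_imp_surj:
  fixes f :: "'a::banach \<Rightarrow> 'b::real_normed_vector"
  assumes f: "bounded_linear f" and D: "subspace D" "closed D"
    and P: "subspace P" and fD: "f ` D \<subseteq> P"
    and approx: "\<And>y. y \<in> P \<Longrightarrow> \<exists>x\<in>D. norm x \<le> C * norm y \<and> norm (y - f x) \<le> norm y / 2"
    and y: "y \<in> P"
  shows "\<exists>x\<in>D. f x = y \<and> norm x \<le> 2 * C * norm y"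
proof -
  interpret f: bounded_linear f by (rule f)
  obtain g where g: "\<And>y. y \<in> P \<Longrightarrow> g y \<in> D \<and> norm (g y) \<le> C * norm y \<and> norm (y - f (g y)) \<le> norm y / 2"
    using approx by metis
  \<comment> \<open>\<open>r n\<close> is the residual left after \<open>n\<close> corrections
    \<open>g (r i)\<close>.\<close>
  define r where "r = (\<lambda>n. ((\<lambda>y. y - f (g y)) ^^ n) y)"
  have r0: "r 0 = y" and rS: "r (Suc n) = r n - f (g (r n))" for n
    by (simp_all add: r_def)
  have rP: "r n \<in> P" for n
    by (induction n) (use y g fD P in \<open>auto simp: r0 rS intro!: subspace_diff\<close>)
  have rn: "norm (r n) \<le> norm y * (1/2)^n" for n
  proof (induction n)
    case (Suc n)
    then show ?case using g[OF rP[of n]] by (simp add: rS)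
  qed (simp add: r0)
  show ?thesis
  proof (cases "y = 0")
    case True
    then show ?thesis using D by (intro bexI[of _ 0]) (auto simp: f.zero subspace_0)
  next
    case False
    \<comment> \<open>The sign of \<open>C\<close> is not assumed; it is read off from a nonzero
      \<open>y\<close>.\<close>
    have C: "C \<ge> 0"
      using order_trans[OF norm_ge_zero, of "g y" "C * norm y"] g[OF y] False
      by (simp add: zero_le_mult_iff)
    define h where "h = (\<lambda>n. g (r n))"
    have hD: "h n \<in> D" for n using g[OF rP] by (simp add: h_def)
    have hn: "norm (h n) \<le> C * norm y * (1/2)^n" for n
      using g[OF rP[of n]] mult_left_mono[OF rn C, of n] by (simp add: h_def mult.assoc)
    have geo: "(\<lambda>n. C * norm y * (1/2)^n) sums (C * norm y * 2)"
      using sums_mult[OF geometric_sums[of "1/2::real"], of "C * norm y"] by simp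
    have sn: "summable (\<lambda>n. norm (h n))"
      by (rule summable_comparison_test'[OF sums_summable[OF geo], of 0]) (use hn in auto)
    then have s: "summable h" by (rule summable_norm_cancel)
    define x where "x = suminf h"
    have xD: "x \<in> D"
    proof (rule closed_sequentially[OF D(2)])
      show "(\<lambda>n. \<Sum>i<n. h i) \<longlonglongrightarrow> x" unfolding x_def by (rule summable_LIMSEQ[OF s])
      show "(\<Sum>i<n. h i) \<in> D" for n using hD D by (intro subspace_sum) auto
    qed
    have "norm x \<le> (\<Sum>n. norm (h n))" unfolding x_def by (rule summable_norm[OF sn])
    also have "\<dots> \<le> C * norm y * 2"
      using suminf_le[OF hn sn sums_summable[OF geo]] sums_unique[OF geo] by simp
    finally have nx: "norm x \<le> 2 * C * norm y" by (simp add: mult_ac)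
    have part: "f (\<Sum>i<n. h i) = y - r n" for n
      by (induction n) (simp_all add: f.zero f.add r0 rS h_def)
    have "(\<lambda>n. norm y * (1/2)^n) \<longlonglongrightarrow> 0"
      by (intro tendsto_mult_right_zero LIMSEQ_power_zero) simp
    then have "r \<longlonglongrightarrow> 0" by (rule Lim_null_comparison[rotated]) (use rn in auto)
    then have "(\<lambda>n. y - r n) \<longlonglongrightarrow> y" by (auto intro!: tendsto_eq_intros)
    moreover have "(\<lambda>n. f (\<Sum>i<n. h i)) \<longlonglongrightarrow> f x"
      unfolding x_def by (intro f.tendsto summable_LIMSEQ[OF s])
    ultimately have "f x = y" unfolding part by (rule LIMSEQ_unique[rotated])
    with xD nx show ?thesis by blast
  qed
qed

text \<open>The open mapping theorem in quantitative form. The closures \<open>A n\<close> of images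
  of balls cover \<open>P\<close>, so by Baire one of them has interior relative to
  \<open>P\<close>; the approximate solutions found there become exact by
  \<open>approx_surj_imp_surj\<close>.\<close>

lemma open_mapping_bound:
  fixes f :: "'a::banach \<Rightarrow> 'b::banach"
  assumes f: "bounded_linear f" and D: "subspace D" "closed D"
    and P: "subspace P" "closed P" and fD: "f ` D = P"
  obtains C where "C > 0" "\<And>y. y \<in> P \<Longrightarrow> \<exists>x\<in>D. f x = y \<and> norm x \<le> C * norm y"
proof -
  interpret f: bounded_linear f by (rule f)
  define A where "A n = closure (f ` (D \<inter> cball 0 (real n)))" for n
  have AP: "A n \<subseteq> P" for n
    unfolding A_def using fD by (intro closure_minimal P) auto
  have "\<exists>n. top_of_set P interior_of A n \<noteq> {}"
  proof (rule ccontr)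
    assume *: "\<nexists>n. top_of_set P interior_of A n \<noteq> {}"
    have "top_of_set P interior_of (\<Union>(range A)) = {}"
    proof (rule Baire_category_alt)
      show "completely_metrizable_space (top_of_set P) \<or> locally_compact_space (top_of_set P) \<and> regular_space (top_of_set P)"
        by (simp add: completely_metrizable_space_closedin[OF completely_metrizable_space_euclidean] P)
      show "closedin (top_of_set P) T \<and> top_of_set P interior_of T = {}" if "T \<in> range A" for T
        using that * AP by (auto simp: A_def intro!: closed_subset)
    qed auto
    moreover have "\<Union>(range A) = P"
    proof (intro equalityI subsetI)
      fix y assume "y \<in> P"
      then obtain x where "x \<in> D" "f x = y" using fD by blast
      moreover obtain n where "norm x \<le> real n" using real_arch_simple by blast
      ultimately have "y \<in> A n" unfolding A_def by (intro subsetD[OF closure_subset]) auto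
      then show "y \<in> \<Union>(range A)" by blast
    qed (use AP in auto)
    ultimately have "P = {}" by (metis interior_of_topspace topspace_euclidean_subtopology)
    then show False using P subspace_0 by blast
  qed
  then obtain n y0 where "y0 \<in> top_of_set P interior_of A n" by blast
  then obtain U where U: "openin (top_of_set P) U" "y0 \<in> U" "U \<subseteq> A n"
    by (auto simp: interior_of_def)
  then obtain e where e: "e > 0" "ball y0 e \<inter> P \<subseteq> A n" "y0 \<in> P"
    by (metis openin_contains_ball subset_iff inf.cobounded1 openin_subset topspace_euclidean_subtopology order_trans)
  \<comment> \<open>Subtracting approximate preimages of \<open>y0 + y\<close> and \<open>y0\<close>
    moves the ball to the origin: the norm bound doubles to \<open>2 * real n\<close>, and two
    errors below \<open>e / 8\<close> give one below \<open>e / 4\<close>.\<close>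
  have small: "\<exists>x\<in>D. norm x \<le> 2 * real n \<and> norm (y - f x) < e / 4" if y: "y \<in> P" "norm y < e" for y
  proof -
    have "y0 + y \<in> ball y0 e \<inter> P" "y0 \<in> ball y0 e \<inter> P"
      using e y P by (auto simp: dist_norm subspace_add)
    then have "y0 + y \<in> A n" "y0 \<in> A n" using e(2) by blast+
    moreover have "\<exists>x\<in>D. norm x \<le> n \<and> dist (f x) z < e / 8" if "z \<in> A n" for z
    proof -
      have "e / 8 > 0" using e by simp
      then obtain w where "w \<in> f ` (D \<inter> cball 0 (real n))" "dist w z < e / 8"
        using \<open>z \<in> A n\<close> unfolding A_def closure_approachable by blast
      then show ?thesis by auto
    qed
    ultimately obtain x1 x0 where x: "x1 \<in> D" "norm x1 \<le> n" "dist (f x1) (y0 + y) < e / 8"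
        "x0 \<in> D" "norm x0 \<le> n" "dist (f x0) y0 < e / 8"
      by blast
    have "norm (y - f (x1 - x0)) = norm ((f x0 - y0) - (f x1 - (y0 + y)))"
      by (simp add: f.diff algebra_simps)
    also have "\<dots> < e / 4" using x norm_triangle_ineq4[of "f x0 - y0" "f x1 - (y0 + y)"] by (simp add: dist_norm)
    finally have "norm (y - f (x1 - x0)) < e / 4" .
    moreover have "norm (x1 - x0) \<le> 2 * real n" using x norm_triangle_ineq4[of x1 x0] by simp
    ultimately show ?thesis using x D by (intro bexI[of _ "x1 - x0"]) (auto intro: subspace_diff)
  qed
  \<comment> \<open>Rescaling \<open>y\<close> to norm \<open>e / 2\<close> and back costs the
    factor \<open>2 * norm y / e\<close>. It brings the bound \<open>2 * real n\<close> below
    \<open>C * norm y\<close> and the error \<open>e / 4\<close> to \<open>norm y / 2\<close>. The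
    \<open>+ 1\<close> keeps \<open>C\<close> positive when \<open>n = 0\<close>.\<close>
  define C where "C = 4 * (real n + 1) / e"
  have approx: "\<exists>x\<in>D. norm x \<le> C * norm y \<and> norm (y - f x) \<le> norm y / 2" if y: "y \<in> P" for y
  proof (cases "y = 0")
    case True
    then show ?thesis using D by (intro bexI[of _ 0]) (auto simp: f.zero subspace_0)
  next
    case False
    define t where "t = e / (2 * norm y)"
    have t: "t > 0" using e False by (simp add: t_def)
    have "norm (t *\<^sub>R y) < e" using e False by (simp add: t_def)
    then obtain x where x: "x \<in> D" "norm x \<le> 2 * real n" "norm (t *\<^sub>R y - f x) < e / 4"
      using small[of "t *\<^sub>R y"] y P subspace_scale by blast
    have "norm (x /\<^sub>R t) = norm x * (2 * norm y / e)"
      using e(1) by (simp add: t_def)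
    also have "\<dots> \<le> (2 * (real n + 1)) * (2 * norm y / e)"
      using x(2) e(1) by (intro mult_right_mono) auto
    also have "\<dots> = C * norm y" by (simp add: C_def)
    finally have "norm (x /\<^sub>R t) \<le> C * norm y" .
    moreover have "y - f (x /\<^sub>R t) = (t *\<^sub>R y - f x) /\<^sub>R t"
      using t by (simp add: f.scaleR algebra_simps)
    then have "norm (y - f (x /\<^sub>R t)) = norm (t *\<^sub>R y - f x) / t" using t by (simp add: divide_inverse)
    moreover have "norm (t *\<^sub>R y - f x) / t \<le> (e / 4) / t" using x t by (intro divide_right_mono) auto
    moreover have "(e / 4) / t = norm y / 2" using e False by (simp add: t_def field_simps)
    ultimately show ?thesis using x D by (intro bexI[of _ "x /\<^sub>R t"]) (auto intro: subspace_scale)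
  qed
  have "C > 0" using e by (simp add: C_def)
  then show ?thesis
    using approx_surj_imp_surj[OF f D P(1) _ approx] fD by (intro that[of "2 * C"]) auto
qed

text \<open>An exact solution of \<open>f x = y\<close> misses \<open>y\<close> under
  \<open>f - h\<close> only by \<open>h x\<close>, which has norm at most half of
  \<open>norm y\<close>. This is the approximate solvability that
  \<open>approx_surj_imp_surj\<close> asks for.\<close>

lemma surj_perturbation:
  fixes f h :: "'a::banach \<Rightarrow> 'b::real_normed_vector"
  assumes f: "bounded_linear f" and h: "bounded_linear h" and D: "subspace D" "closed D"
    and P: "subspace P" and fD: "f ` D \<subseteq> P" and hD: "h ` D \<subseteq> P"
    and bound: "\<And>y. y \<in> P \<Longrightarrow> \<exists>x\<in>D. f x = y \<and> norm x \<le> C * norm y"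
    and small: "\<And>x. x \<in> D \<Longrightarrow> norm (h x) \<le> \<delta> * norm x" and \<delta>: "\<delta> \<ge> 0" "\<delta> * C \<le> 1/2"
    and y: "y \<in> P"
  shows "\<exists>x\<in>D. f x - h x = y \<and> norm x \<le> 2 * C * norm y"
proof (rule approx_surj_imp_surj[OF bounded_linear_sub[OF f h] D P _ _ y])
  show "(\<lambda>x. f x - h x) ` D \<subseteq> P" using fD hD P by (auto intro!: subspace_diff)
  fix y assume "y \<in> P"
  then obtain x where x: "x \<in> D" "f x = y" "norm x \<le> C * norm y" using bound by blast
  have "norm (h x) \<le> \<delta> * (C * norm y)" using small[OF x(1)] mult_left_mono[OF x(3) \<delta>(1)] by linarith
  also have "\<dots> \<le> norm y / 2" using mult_right_mono[OF \<delta>(2), of "norm y"] by (simp add: mult_ac)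
  finally show "\<exists>x\<in>D. norm x \<le> C * norm y \<and> norm (y - (f x - h x)) \<le> norm y / 2"
    using x by auto
qed

lemma closed_image_of_closed_complement:
  fixes f :: "'a::banach \<Rightarrow> 'b::banach"
  assumes f: "bounded_linear f" and D: "subspace D" "closed D"
    and F: "subspace F" "closed F" and P: "subspace P" "closed P"
    and sum: "{f x + y |x y. x \<in> D \<and> y \<in> F} = P" and int: "f ` D \<inter> F \<subseteq> {0}"
  shows "closed (f ` D)"
proof -
  interpret f: bounded_linear f by (rule f)
  let ?g = "\<lambda>p::'a \<times> 'b. f (fst p) + snd p"
  have g: "bounded_linear ?g"
    by (intro bounded_linear_add bounded_linear_compose[OF f] bounded_linear_fst bounded_linear_snd)
  have "?g ` (D \<times> F) = P" using sum by force
  from open_mapping_bound[OF g subspace_Times[OF D(1) F(1)] closed_Times[OF D(2) F(2)] P this]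
  obtain C where C: "C > 0" "\<And>y. y \<in> P \<Longrightarrow> \<exists>p\<in>D \<times> F. ?g p = y \<and> norm p \<le> C * norm y" by blast
  have eq: "a = f x \<and> b = 0" if "a \<in> f ` D" "b \<in> F" "a + b = f x" "x \<in> D" for a b x
  proof -
    have "f x - a \<in> f ` D" using that D by (auto simp: f.diff[symmetric] intro!: imageI subspace_diff[of D])
    moreover have "f x - a = b" using that by (simp add: algebra_simps)
    ultimately show ?thesis using that int by auto
  qed
  show ?thesis unfolding closed_sequential_limits
  proof safe
    fix s l assume s: "\<forall>n. s n \<in> f ` D" "s \<longlonglongrightarrow> l"
    have fDP: "f ` D \<subseteq> P" using sum subspace_0[OF F(1)] by force
    then have sP: "s n \<in> P" for n using s(1) by blast
    then have "l \<in> P" using closed_sequentially[OF P(2) _ s(2)] by blast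
    then obtain x y where xy: "x \<in> D" "y \<in> F" "l = f x + y" unfolding sum[symmetric] by blast
    have "norm y \<le> C * norm (s n - l)" for n
    proof -
      have "s n - l \<in> P" using sP \<open>l \<in> P\<close> P(1) by (simp add: subspace_diff)
      from C(2)[OF this] obtain u v where uv: "u \<in> D" "v \<in> F" "f u + v = s n - l" "norm (u, v) \<le> C * norm (s n - l)"
        by auto
      obtain w where w: "w \<in> D" "s n = f w" using s by blast
      have "v + y = 0"
      proof -
        have "f (u + x) + (v + y) = f w" using uv w xy by (simp add: f.add algebra_simps)
        then show ?thesis
          using eq[of "f (u + x)" "v + y" w] uv xy w D F by (auto intro: subspace_add)
      qed
      then have "norm y = norm v" by (metis add_eq_0_iff norm_minus_cancel)
      also have "\<dots> \<le> norm (u, v)" using norm_snd_le[of v u] by simp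
      finally show ?thesis using uv by linarith
    qed
    moreover have "(\<lambda>n. C * norm (s n - l)) \<longlonglongrightarrow> C * norm (l - l)"
      by (intro tendsto_intros s)
    ultimately have "norm y \<le> 0" by (intro LIMSEQ_le_const[of "\<lambda>n. C * norm (s n - l)"]) auto
    then show "l \<in> f ` D" using xy by auto
  qed
qed

section \<open>Finite-dimensional complex subspaces\<close>

interpretation complex_vector: vector_space "scaleC :: complex \<Rightarrow> 'a \<Rightarrow> 'a::complex_vector_space"
  by unfold_locales (simp_all add: scaleC_add_right scaleC_add_left scaleC_scaleC scaleC_one)

lemma subspace_if_csubspace: "complex_vector.subspace M \<Longrightarrow> subspace M"
  unfolding subspace_def complex_vector.subspace_def by (simp add: scaleR_scaleC)

lemma bounded_bilinear_scaleC:
  "bounded_bilinear (scaleC :: complex \<Rightarrow> 'a \<Rightarrow> 'a::complex_normed_vector_space)"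
  by unfold_locales (auto simp: scaleC_add_right scaleC_add_left scaleC_scaleC scaleR_scaleC mult_ac
      norm_scaleC scaleR_conv_of_real intro!: exI[of _ 1])

lemma subset_cspan: "S \<subseteq> cspan S"
  by (simp add: cspan_def complex_vector.span_superset)

lemma csubspace_cspan: "complex_vector.subspace (cspan S)"
  by (simp add: cspan_def)

lemma cspan_minimal: "S \<subseteq> M \<Longrightarrow> complex_vector.subspace M \<Longrightarrow> cspan S \<subseteq> M"
  by (simp add: cspan_def complex_vector.span_minimal)

text \<open>\<open>fin_dim\<close> asks for a spanning set inside \<open>L\<close>, which
  \<open>B\<close> need not be. A maximal independent subset of \<open>L\<close> serves, and it is
  finite because it is independent in \<open>cspan B\<close>.\<close>

lemma fin_dim_subset:
  assumes L: "complex_vector.subspace L" and "L \<subseteq> cspan B" "finite B"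
  shows "fin_dim L"
proof -
  obtain C where C: "C \<subseteq> L" "complex_vector.independent C" "L \<subseteq> complex_vector.span C"
    using complex_vector.maximal_independent_subset by metis
  have "finite C"
    using complex_vector.independent_span_bound[OF \<open>finite B\<close> C(2)] C(1) assms(2) by (auto simp: cspan_def)
  then show ?thesis
    using C cspan_minimal[OF C(1) L] unfolding fin_dim_def cspan_def by blast
qed

lemma fin_dim_mono: "fin_dim M \<Longrightarrow> complex_vector.subspace L \<Longrightarrow> L \<subseteq> M \<Longrightarrow> fin_dim L"
  unfolding fin_dim_def[of M] using fin_dim_subset by blast

lemma fin_dim_cspan: "finite B \<Longrightarrow> fin_dim (cspan B)"
  using subset_cspan unfolding fin_dim_def by blast

lemma fin_dim_zero: "fin_dim {0}"
  using fin_dim_cspan[of "{}"] by (simp add: cspan_def)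

text \<open>Take \<open>m\<close> of least dimension among the indices from \<open>n\<close> on. If
  some later \<open>N k\<close> were strictly smaller, a basis of it and one more vector of
  \<open>N m\<close> would extend to a basis of \<open>N m\<close>, so \<open>N k\<close> would have
  dimension below the minimum.\<close>

lemma fin_dim_decseq_stabilises:
  assumes N: "fin_dim (N n)" "\<And>k. complex_vector.subspace (N k)" and dec: "\<And>k. N (Suc k) \<subseteq> N k"
  obtains m where "m \<ge> n" "\<And>k. k \<ge> m \<Longrightarrow> N k = N m"
proof -
  have mono: "N k \<subseteq> N j" if "j \<le> k" for j k
    using dec that by (rule lift_Suc_antimono_le)
  have fd: "fin_dim (N k)" if "k \<ge> n" for k
    using fin_dim_mono[OF N(1) N(2) mono[OF that]] .
  define m where "m = (ARG_MIN (\<lambda>k. complex_vector.dim (N k)) k. k \<ge> n)"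
  have m: "m \<ge> n" "\<And>k. k \<ge> n \<Longrightarrow> complex_vector.dim (N m) \<le> complex_vector.dim (N k)"
    using arg_min_nat_lemma[of "\<lambda>k. k \<ge> n" n "\<lambda>k. complex_vector.dim (N k)"] by (auto simp: m_def)
  have "N k = N m" if km: "k \<ge> m" for k
  proof (rule ccontr)
    assume "N k \<noteq> N m"
    then obtain x where x: "x \<in> N m" "x \<notin> N k" using mono[OF km] by blast
    obtain B where B: "B \<subseteq> N k" "complex_vector.independent B" "N k \<subseteq> complex_vector.span B"
      "card B = complex_vector.dim (N k)"
      using complex_vector.basis_exists[of "N k"] by metis
    have sB: "complex_vector.span B = N k" using B N(2) by (metis complex_vector.span_subspace)
    obtain C where C: "finite C" "C \<subseteq> N m" "cspan C = N m" using fd[OF m(1)] unfolding fin_dim_def by blast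
    have ind: "complex_vector.independent (insert x B)"
      using x sB B by (simp add: complex_vector.independent_insert)
    have "insert x B \<subseteq> cspan C" using x B mono[OF km] C by auto
    then have fin: "finite (insert x B)"
      using complex_vector.independent_span_bound[OF C(1) ind] by (simp add: cspan_def)
    obtain E where E: "insert x B \<subseteq> E" "E \<subseteq> N m" "complex_vector.independent E" "N m \<subseteq> complex_vector.span E"
      using complex_vector.maximal_independent_subset_extend[of "insert x B" "N m"] ind x B mono[OF km] by blast
    have "finite E" using complex_vector.independent_span_bound[OF C(1) E(3)] E(2) C by (auto simp: cspan_def)
    have "card B < card (insert x B)" using fin x B by (metis card_insert_disjoint finite_insert lessI subsetD)
    also have "\<dots> \<le> card E" using E \<open>finite E\<close> by (intro card_mono)
    also have "card E = complex_vector.dim (N m)" using complex_vector.basis_card_eq_dim E by blast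
    finally show False using m km B(4) by (metis linorder_not_less order_trans)
  qed
  then show ?thesis using m that by blast
qed

text \<open>The spanning half of rank-nullity: lifts of generators of the image, together with
  generators of the kernel, span \<open>K\<close>.\<close>

lemma fin_dim_preimage:
  fixes S :: "'a::complex_vector_space \<Rightarrow> 'a"
  assumes S: "Vector_Spaces.linear scaleC scaleC S" and K: "complex_vector.subspace K"
    and im: "fin_dim (S ` K)" and ker: "fin_dim (kernel S \<inter> K)"
  shows "fin_dim K"
proof -
  interpret S: Vector_Spaces.linear scaleC scaleC S by (rule S)
  obtain B where B: "finite B" "B \<subseteq> S ` K" "cspan B = S ` K" using im unfolding fin_dim_def by blast
  obtain C where C: "finite C" "C \<subseteq> K" "S ` C = B" using finite_subset_image[OF B(1,2)] by blast
  obtain E where E: "finite E" "E \<subseteq> kernel S \<inter> K" "cspan E = kernel S \<inter> K" using ker unfolding fin_dim_def by blast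
  have "K \<subseteq> cspan (C \<union> E)"
  proof
    fix x assume x: "x \<in> K"
    have "S x \<in> S ` cspan C"
      using x B(3) C(3) unfolding cspan_def by (simp add: S.span_image[symmetric])
    then obtain c where c: "c \<in> cspan C" "S x = S c" by blast
    have "c \<in> K" using c cspan_minimal[OF C(2) K] by blast
    then have "x - c \<in> cspan E" unfolding E using x c K
      by (auto simp: kernel_def S.diff complex_vector.subspace_diff)
    moreover have "x = c + (x - c)" by simp
    ultimately show "x \<in> cspan (C \<union> E)"
      using c unfolding cspan_def complex_vector.span_Un by blast
  qed
  then show ?thesis using fin_dim_subset[OF K] C(1) E(1) by blast
qed

text \<open>Induction on the generators, with closedness drawn from compactness of the balls at each
  stage. A new generator has positive distance from the closed span so far, which bounds its
  coefficient.\<close>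

lemma compact_fin_dim_ball:
  fixes M :: "'a::complex_normed_vector_space set"
  assumes "fin_dim M"
  shows closed_fin_dim: "closed M" and compact_fin_dim_Int_cball: "compact (M \<inter> cball 0 r)"
proof -
  have closed_if: "closed L" if L: "\<And>r. compact (L \<inter> cball 0 r)" for L :: "'a set"
  proof -
    have "y \<in> L" if y: "y \<in> closure L" for y
    proof -
      have "y \<in> ball 0 (norm y + 1) \<inter> closure L" using y by simp
      then have "y \<in> closure (ball 0 (norm y + 1) \<inter> L)"
        using open_Int_closure_subset[OF open_ball] by blast
      also have "\<dots> \<subseteq> closure (L \<inter> cball 0 (norm y + 1))" by (intro closure_mono) auto
      also have "\<dots> \<subseteq> L" using compact_imp_closed[OF L] by simp
      finally show ?thesis .
    qed
    then show ?thesis by (metis closure_subset closure_eq subsetI subset_antisym)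
  qed
  have "compact (cspan B \<inter> cball 0 r)" if "finite B" for B :: "'a set" and r :: real
    using that
  proof (induction B arbitrary: r rule: finite_induct)
    case empty
    then show ?case by (simp add: cspan_def Int_insert_left)
  next
    case (insert x B)
    let ?L = "cspan B"
    have L: "complex_vector.subspace ?L" by (rule csubspace_cspan)
    have cl: "closed ?L" by (rule closed_if[OF insert.IH])
    show ?case
    proof (cases "x \<in> ?L")
      case True
      then have "cspan (insert x B) = cspan B"
        by (simp add: cspan_def complex_vector.span_redundant)
      then show ?thesis using insert.IH by simp
    next
      case False
      define d where "d = infdist x ?L"
      have ne: "?L \<noteq> {}" using complex_vector.subspace_0[OF L] by blast
      have d: "d > 0"
        using False cl ne infdist_nonneg[of x ?L] in_closed_iff_infdist_zero[OF cl ne, of x] by (auto simp: d_def)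
      \<comment> \<open>Dividing by \<open>t\<close> turns \<open>l + t x\<close> into
        \<open>x\<close> minus an element of the span, whose norm is at least
        \<open>d\<close>.\<close>
      have tb: "cmod t * d \<le> norm (l + scaleC t x)" if l: "l \<in> ?L" for l t
      proof (cases "t = 0")
        case False
        have "- scaleC (1/t) l \<in> ?L" using l L by (simp add: complex_vector.subspace_neg complex_vector.subspace_scale)
        then have "d \<le> dist x (- scaleC (1/t) l)" unfolding d_def by (rule infdist_le)
        then have "cmod t * d \<le> cmod t * norm (x + scaleC (1/t) l)" by (simp add: dist_norm mult_left_mono)
        also have "\<dots> = norm (scaleC t (x + scaleC (1/t) l))" by (simp add: norm_scaleC)
        also have "\<dots> = norm (l + scaleC t x)" using False by (simp add: scaleC_add_right scaleC_scaleC scaleC_one add.commute)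
        finally show ?thesis .
      qed simp
      \<comment> \<open>In a ball of radius \<open>r\<close> the coefficient of \<open>x\<close> is
        at most \<open>r / d\<close>, so the remaining component has norm at most
        \<open>r1\<close>.\<close>
      define r1 where "r1 = r + (r / d) * norm x"
      let ?g = "\<lambda>p. fst p + scaleC (snd p) x"
      have "cspan (insert x B) \<inter> cball 0 r = ?g ` ((?L \<inter> cball 0 r1) \<times> cball 0 (r / d)) \<inter> cball 0 r"
      proof (intro equalityI subsetI)
        fix z assume z: "z \<in> cspan (insert x B) \<inter> cball 0 r"
        then obtain t where t: "z - scaleC t x \<in> ?L" by (auto simp: cspan_def complex_vector.span_insert)
        have tr: "cmod t \<le> r / d" using tb[OF t, of t] z d by (simp add: field_simps)
        have "norm (z - scaleC t x) \<le> norm z + cmod t * norm x"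
          using norm_triangle_ineq4[of z "scaleC t x"] by (simp add: norm_scaleC)
        also have "\<dots> \<le> r1" unfolding r1_def using z tr by (intro add_mono mult_right_mono) auto
        finally have "(z - scaleC t x, t) \<in> (?L \<inter> cball 0 r1) \<times> cball 0 (r / d)" using t tr by simp
        then show "z \<in> ?g ` ((?L \<inter> cball 0 r1) \<times> cball 0 (r / d)) \<inter> cball 0 r"
          using z by (intro IntI image_eqI[of _ _ "(z - scaleC t x, t)"]) auto
      next
        fix z assume "z \<in> ?g ` ((?L \<inter> cball 0 r1) \<times> cball 0 (r / d)) \<inter> cball 0 r"
        then obtain p where "z = ?g p" "fst p \<in> ?L" "z \<in> cball 0 r" by auto
        then have "z - scaleC (snd p) x \<in> ?L" "z \<in> cball 0 r" by auto
        then show "z \<in> cspan (insert x B) \<inter> cball 0 r" by (auto simp: cspan_def complex_vector.span_insert)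
      qed
      moreover have "compact (?g ` ((?L \<inter> cball 0 r1) \<times> cball 0 (r / d)))"
        using insert.IH
        by (intro compact_continuous_image compact_Times compact_cball continuous_intros
            bounded_bilinear.continuous_on[OF bounded_bilinear_scaleC])
      ultimately show ?thesis by (simp add: compact_Int_closed)
    qed
  qed
  then show "compact (M \<inter> cball 0 r)" for r using assms unfolding fin_dim_def by blast
  then show "closed M" by (rule closed_if)
qed

text \<open>Riesz's argument: a finite net in the unit sphere spans a closed subspace, which the remaining
  vectors cannot avoid.\<close>
lemma fin_dim_if_near_fin_dim:
  fixes K N :: "'a::complex_normed_vector_space set"
  assumes K: "complex_vector.subspace K" and N: "fin_dim N"
    and near: "\<And>x. x \<in> K \<Longrightarrow> \<exists>y\<in>N. norm (x - y) \<le> norm x / 8"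
  shows "fin_dim K"
proof -
  let ?S = "{x \<in> K. norm x = 1}"
  have comp: "compact (N \<inter> cball 0 2)" by (rule compact_fin_dim_Int_cball[OF N])
  \<comment> \<open>Radius 2 suffices, since only points within 1/8 of a unit vector matter. The net
    in \<open>N\<close> is then replaced by unit vectors of \<open>K\<close>: errors 1/8 + 1/8 give
    1/4, and 1/4 + 1/4 give the final 1/2.\<close>
  have "N \<inter> cball 0 2 \<subseteq> (\<Union>y\<in>N \<inter> cball 0 2. ball y (1/8))" by auto
  then obtain Y where Y: "Y \<subseteq> N \<inter> cball 0 2" "finite Y" "N \<inter> cball 0 2 \<subseteq> (\<Union>y\<in>Y. ball y (1/8))"
    using compactE_image[OF comp, of "N \<inter> cball 0 2" "\<lambda>y. ball y (1/8)"] by (metis open_ball)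
  define c where "c y = (SOME x. x \<in> ?S \<and> dist x y < 1/4)" for y
  have c: "c y \<in> ?S \<and> dist (c y) y < 1/4" if "x \<in> ?S" "dist x y < 1/4" for x y
    unfolding c_def by (rule someI[where P = "\<lambda>x. x \<in> ?S \<and> dist x y < 1/4"]) (use that in blast)
  define Z where "Z = c ` {y \<in> Y. \<exists>x\<in>?S. dist x y < 1/4}"
  have Z: "finite Z" "Z \<subseteq> K" using Y c by (auto simp: Z_def)
  have netS: "\<exists>z\<in>Z. norm (x - z) \<le> 1/2" if x: "x \<in> ?S" for x
  proof -
    obtain y where y: "y \<in> N" "norm (x - y) \<le> 1/8" using near x by fastforce
    then have "norm y \<le> 2" using x norm_triangle_ineq2[of y x] by (simp add: norm_minus_commute)
    then obtain w where w: "w \<in> Y" "dist w y < 1/8" using Y y by fastforce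
    have "dist x w < 1/4" using w y dist_triangle[of x w y] by (simp add: dist_norm norm_minus_commute)
    then have "c w \<in> Z" "dist (c w) w < 1/4" using w x c[OF x, of w] by (auto simp: Z_def)
    then show ?thesis using \<open>dist x w < 1/4\<close> dist_triangle2[of x "c w" w]
      by (intro bexI[of _ "c w"]) (auto simp: dist_norm)
  qed
  let ?F = "cspan Z"
  have F: "complex_vector.subspace ?F" "closed ?F" "?F \<noteq> {}"
    using csubspace_cspan closed_fin_dim[OF fin_dim_cspan[OF Z(1)]] complex_vector.subspace_0[OF csubspace_cspan] by blast+
  have FK: "?F \<subseteq> K" using cspan_minimal[OF Z(2) K] .
  have net: "\<exists>z\<in>?F. norm (x - z) \<le> norm x / 2" if x: "x \<in> K" for x
  proof (cases "x = 0")
    case True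
    then show ?thesis using complex_vector.subspace_0[OF F(1)] by auto
  next
    case False
    let ?a = "complex_of_real (norm x)"
    have "scaleC (1 / ?a) x \<in> ?S"
      using x K False by (simp add: complex_vector.subspace_scale norm_scaleC norm_divide)
    then obtain z where z: "z \<in> Z" "norm (scaleC (1 / ?a) x - z) \<le> 1/2" using netS by blast
    have "x - scaleC ?a z = scaleC ?a (scaleC (1 / ?a) x - z)"
      using False by (simp add: complex_vector.scale_right_diff_distrib scaleC_scaleC scaleC_one)
    then have "norm (x - scaleC ?a z) = norm x * norm (scaleC (1 / ?a) x - z)" by (simp add: norm_scaleC)
    also have "\<dots> \<le> norm x * (1/2)" using z by (intro mult_left_mono) auto
    finally show ?thesis
      using z F(1) subset_cspan[of Z] by (intro bexI[of _ "scaleC ?a z"]) (auto simp: complex_vector.subspace_scale)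
  qed
  have "x \<in> ?F" if x: "x \<in> K" for x
  proof (rule ccontr)
    assume "x \<notin> ?F"
    then have d: "infdist x ?F > 0"
      using infdist_nonneg[of x ?F] in_closed_iff_infdist_zero[OF F(2,3), of x] by auto
    \<comment> \<open>A nearly closest \<open>f\<close>, up to the factor 3/2, followed by a
      correction that halves the error, would come within 3/4 of the distance from \<open>x\<close>
      to \<open>?F\<close>.\<close>
    have "\<exists>f\<in>?F. dist x f < 3/2 * infdist x ?F"
    proof (rule ccontr)
      assume "\<not> ?thesis"
      then have "3/2 * infdist x ?F \<le> infdist x ?F"
        unfolding infdist_notempty[OF F(3)] by (intro cINF_greatest F(3)) (auto simp: not_less)
      then show False using d by simp
    qed
    then obtain f where f: "f \<in> ?F" "dist x f < 3/2 * infdist x ?F" by blast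
    then have "x - f \<in> K" using x FK K by (auto intro: complex_vector.subspace_diff)
    then obtain z where z: "z \<in> ?F" "norm (x - f - z) \<le> norm (x - f) / 2" using net by blast
    have "infdist x ?F \<le> dist x (f + z)" using f z F(1) by (intro infdist_le) (simp add: complex_vector.subspace_add)
    also have "\<dots> = norm (x - f - z)" by (simp add: dist_norm algebra_simps)
    finally show False using z f d by (simp add: dist_norm)
  qed
  then show ?thesis using fin_dim_subset[OF K _ Z(1)] by blast
qed

section \<open>Ascent, descent and closed ranges\<close>

lemma bounded_op_linear: "bounded_op T \<Longrightarrow> Vector_Spaces.linear scaleC scaleC T"
  unfolding bounded_op_def
  by unfold_locales (auto simp: bounded_linear.linear[THEN linear_add])

lemma bounded_op_bounded_linear: "bounded_op T \<Longrightarrow> bounded_linear T"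
  by (simp add: bounded_op_def)

lemma bounded_linear_scaleC: "bounded_linear (scaleC z :: 'a \<Rightarrow> 'a::complex_normed_vector_space)"
  by (rule bounded_bilinear.bounded_linear_right[OF bounded_bilinear_scaleC])

lemma bounded_op_shift: "bounded_op T \<Longrightarrow> bounded_op (shift T z)"
  unfolding bounded_op_def shift_def
  by (auto intro!: bounded_linear_sub bounded_linear_scaleC
      simp: complex_vector.scale_right_diff_distrib scaleC_scaleC mult.commute)

lemma bounded_op_funpow: "bounded_op T \<Longrightarrow> bounded_op (T ^^ k)"
proof (induction k)
  case (Suc k)
  then show ?case by (auto simp: bounded_op_def o_def intro: bounded_linear_compose)
qed (simp add: bounded_op_def id_def bounded_linear_ident)

lemma csubspace_image:
  assumes "bounded_op T" "complex_vector.subspace M"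
  shows "complex_vector.subspace (T ` M)"
proof -
  interpret Vector_Spaces.linear scaleC scaleC T by (rule bounded_op_linear[OF assms(1)])
  show ?thesis by (rule subspace_image[OF assms(2)])
qed

lemma csubspace_kernel:
  assumes "bounded_op T"
  shows "complex_vector.subspace (kernel T)"
proof -
  interpret Vector_Spaces.linear scaleC scaleC T by (rule bounded_op_linear[OF assms])
  show ?thesis unfolding kernel_def by (rule subspace_kernel)
qed

lemma closed_kernel: "bounded_op T \<Longrightarrow> closed (kernel T)"
  unfolding kernel_def
  by (intro closed_Collect_eq continuous_intros linear_continuous_on bounded_op_bounded_linear)

lemma csubspace_range_funpow: "bounded_op T \<Longrightarrow> complex_vector.subspace (range (T ^^ k))"
  by (intro csubspace_image bounded_op_funpow complex_vector.subspace_UNIV)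

lemma range_funpow_Suc:
  fixes T :: "'a \<Rightarrow> 'a"
  shows "range (T ^^ Suc k) = T ` range (T ^^ k)"
  by (auto simp: image_comp)

lemma range_funpow_antimono:
  fixes T :: "'a \<Rightarrow> 'a"
  assumes "j \<le> k"
  shows "range (T ^^ k) \<subseteq> range (T ^^ j)"
  using funpow_add[of j "k - j" T] assms by auto

lemma bounded_op_zero: "bounded_op T \<Longrightarrow> T 0 = 0"
  using bounded_op_bounded_linear linear_simps(3) by blast

lemma kernel_funpow_mono:
  assumes "bounded_op T" "j \<le> k"
  shows "kernel (T ^^ j) \<subseteq> kernel (T ^^ k)"
proof -
  have "(T ^^ k) x = (T ^^ (k - j)) ((T ^^ j) x)" for x
    using assms(2) by (metis comp_apply funpow_add le_add_diff_inverse2)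
  then show ?thesis
    using bounded_op_zero[OF bounded_op_funpow[OF assms(1)]] by (auto simp: kernel_def)
qed

lemma kernel_funpow_stable:
  assumes "kernel (T ^^ n) = kernel (T ^^ Suc n)" "n \<le> k"
  shows "kernel (T ^^ k) = kernel (T ^^ n)"
  using assms(2)
proof (induction k rule: dec_induct)
  case (step k)
  have "x \<in> kernel (T ^^ Suc k) \<longleftrightarrow> T x \<in> kernel (T ^^ k)" for x
    by (simp add: kernel_def funpow_swap1)
  moreover have "x \<in> kernel (T ^^ Suc n) \<longleftrightarrow> T x \<in> kernel (T ^^ n)" for x
    by (simp add: kernel_def funpow_swap1)
  ultimately show ?case using step.IH assms(1) by blast
qed simp

lemma range_funpow_stable:
  fixes T :: "'a \<Rightarrow> 'a"
  assumes "range (T ^^ n) = range (T ^^ Suc n)" "n \<le> k"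
  shows "range (T ^^ k) = range (T ^^ n)"
  using assms(2)
proof (induction k rule: dec_induct)
  case (step k)
  then have "range (T ^^ Suc k) = range (T ^^ Suc n)" by (simp only: range_funpow_Suc)
  then show ?case by (simp only: assms(1)[symmetric])
qed simp

section \<open>Decomposition of the space under finite ascent and descent\<close>

lemma ascent_finite_iff: "ascent S < \<infinity> \<longleftrightarrow> (\<exists>n. kernel (S ^^ n) = kernel (S ^^ Suc n))"
  by (auto simp: ascent_def)

lemma descent_finite_iff: "descent S < \<infinity> \<longleftrightarrow> (\<exists>n. range (S ^^ n) = range (S ^^ Suc n))"
  by (auto simp: descent_def)

text \<open>For large \<open>k\<close> the operators \<open>S ^^ k\<close> and
  \<open>S ^^ (k + k)\<close> have the same kernel and the same range. Equality of kernels makes the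
  intersection trivial; equality of ranges makes the sum the whole space.\<close>

lemma finite_ascent_descent_decomposition:
  assumes S: "bounded_op S" and fin: "ascent S < \<infinity>" "descent S < \<infinity>"
  obtains k where "kernel (S ^^ k) \<inter> range (S ^^ k) = {0}"
    "\<And>x. \<exists>u\<in>kernel (S ^^ k). \<exists>v\<in>range (S ^^ k). x = v + u"
    "range (S ^^ Suc k) = range (S ^^ k)" "k > 0"
proof -
  obtain p q where p: "kernel (S ^^ p) = kernel (S ^^ Suc p)" and q: "range (S ^^ q) = range (S ^^ Suc q)"
    using fin unfolding ascent_finite_iff descent_finite_iff by blast
  \<comment> \<open>The successor makes \<open>k\<close> positive, so that later
    \<open>kernel S\<close> lies in \<open>kernel (S ^^ k)\<close> and \<open>range (S ^^ k)\<close>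
    in \<open>range S\<close>.\<close>
  define k where "k = Suc (max p q)"
  note lin = bounded_op_linear[OF bounded_op_funpow[OF S], of k]
  interpret Sk: Vector_Spaces.linear scaleC scaleC "S ^^ k" by (rule lin)
  have K: "kernel (S ^^ (k + k)) = kernel (S ^^ k)"
    using kernel_funpow_stable[OF p, of "k + k"] kernel_funpow_stable[OF p, of k] by (simp add: k_def)
  have R: "range (S ^^ (k + k)) = range (S ^^ k)" "range (S ^^ Suc k) = range (S ^^ k)"
    using range_funpow_stable[OF q, of "k + k"] range_funpow_stable[OF q, of k] range_funpow_stable[OF q, of "Suc k"]
    by (simp_all add: k_def)
  have kk: "(S ^^ (k + k)) x = (S ^^ k) ((S ^^ k) x)" for x by (simp add: funpow_add)
  show ?thesis
  proof (rule that)
    show "kernel (S ^^ k) \<inter> range (S ^^ k) = {0}"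
    proof (intro equalityI subsetI)
      fix y assume "y \<in> kernel (S ^^ k) \<inter> range (S ^^ k)"
      then obtain x where x: "y = (S ^^ k) x" "(S ^^ k) y = 0" by (auto simp: kernel_def)
      then have "x \<in> kernel (S ^^ (k + k))" by (simp add: kernel_def kk)
      then have "x \<in> kernel (S ^^ k)" by (simp only: K)
      then show "y \<in> {0}" using x(1) by (simp add: kernel_def)
    qed (auto simp: kernel_def Sk.zero intro!: image_eqI[of _ _ 0])
    show "\<exists>u\<in>kernel (S ^^ k). \<exists>v\<in>range (S ^^ k). x = v + u" for x
    proof -
      have "(S ^^ k) x \<in> range (S ^^ (k + k))" using R by blast
      then obtain y where "(S ^^ k) x = (S ^^ k) ((S ^^ k) y)" by (auto simp: kk)
      then have "x - (S ^^ k) y \<in> kernel (S ^^ k)" by (simp add: kernel_def Sk.diff)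
      then show ?thesis by (intro bexI[of _ "x - (S ^^ k) y"] bexI[of _ "(S ^^ k) y"]) auto
    qed
    show "range (S ^^ Suc k) = range (S ^^ k)" by (rule R)
    show "k > 0" by (simp add: k_def)
  qed
qed

text \<open>Generators already in the span of \<open>R\<close> and the others are dropped; those
  kept are independent modulo \<open>R\<close>, so their span meets \<open>R\<close> only in
  zero.\<close>

lemma fin_codim_complement:
  assumes R: "complex_vector.subspace R" and B: "finite B"
  shows "\<exists>C\<subseteq>B. cspan (R \<union> C) = cspan (R \<union> B) \<and> R \<inter> cspan C \<subseteq> {0}"
  using B
proof (induction B rule: finite_induct)
  case empty
  show ?case by (intro exI[of _ "{}"]) (simp add: cspan_def)
next
  case (insert x B)
  obtain C where C: "C \<subseteq> B" "cspan (R \<union> C) = cspan (R \<union> B)" "R \<inter> cspan C \<subseteq> {0}"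
    using insert.IH by (elim exE conjE)
  show ?case
  proof (cases "x \<in> cspan (R \<union> B)")
    case True
    then have "cspan (R \<union> insert x B) = cspan (R \<union> B)" by (simp add: cspan_def complex_vector.span_redundant)
    then show ?thesis using C by (intro exI[of _ C]) auto
  next
    case False
    have "cspan (R \<union> insert x C) = cspan (R \<union> insert x B)"
      using C(2) by (simp add: cspan_def complex_vector.span_insert)
    moreover have "R \<inter> cspan (insert x C) \<subseteq> {0}"
    proof
      fix v assume v: "v \<in> R \<inter> cspan (insert x C)"
      then obtain t where t: "v - scaleC t x \<in> cspan C" by (auto simp: cspan_def complex_vector.span_insert)
      show "v \<in> {0}"
      proof (cases "t = 0")
        case True
        then show ?thesis using t v C(3) by auto
      next
        case tn: False
        have "v \<in> cspan (R \<union> C)" "v - scaleC t x \<in> cspan (R \<union> C)"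
          using v t subset_cspan[of "R \<union> C"] complex_vector.span_mono[of C "R \<union> C"] by (auto simp: cspan_def)
        \<comment> \<open>A nonzero coefficient \<open>t\<close> would let \<open>x\<close> be
          solved for inside the old span, against the choice of \<open>x\<close>.\<close>
        then have "v - (v - scaleC t x) \<in> cspan (R \<union> C)"
          by (rule complex_vector.subspace_diff[OF csubspace_cspan])
        then have "scaleC (1 / t) (scaleC t x) \<in> cspan (R \<union> C)"
          by (intro complex_vector.subspace_scale[OF csubspace_cspan, of _ _ "1 / t"]) simp
        then have "x \<in> cspan (R \<union> C)" using tn by (simp add: scaleC_scaleC scaleC_one)
        then show ?thesis using False C by simp
      qed
    qed
    ultimately show ?thesis using C(1) by (intro exI[of _ "insert x C"]) auto
  qed
qed

lemma cspan_csubspace_Un: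
  assumes "complex_vector.subspace R"
  shows "cspan (R \<union> B) = {r + b |r b. r \<in> R \<and> b \<in> cspan B}"
  using assms unfolding cspan_def complex_vector.span_Un by (metis complex_vector.span_eq_iff)

text \<open>Finite codimension of an operator range already forces closedness: it has a
  finite-dimensional, hence closed, complement in \<open>P\<close>.\<close>

lemma closed_image_of_fin_codim:
  assumes S: "bounded_op S" and D: "complex_vector.subspace D" "closed D"
    and P: "complex_vector.subspace P" "closed P" and SD: "S ` D \<subseteq> P" and cod: "fin_codim_in P (S ` D)"
  shows "closed (S ` D)"
proof -
  have R: "complex_vector.subspace (S ` D)" by (rule csubspace_image[OF S D(1)])
  obtain B where B: "finite B" "B \<subseteq> P" "P \<subseteq> cspan (S ` D \<union> B)" using cod unfolding fin_codim_in_def by blast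
  obtain C where C: "C \<subseteq> B" "cspan (S ` D \<union> C) = cspan (S ` D \<union> B)" "S ` D \<inter> cspan C \<subseteq> {0}"
    using fin_codim_complement[OF R B(1)] by blast
  have "cspan (S ` D \<union> C) = P"
    using B C cspan_minimal[of "S ` D \<union> C" P] SD P(1) by (metis Un_least order_trans subset_antisym)
  then have sum: "{S x + y |x y. x \<in> D \<and> y \<in> cspan C} = P"
    unfolding cspan_csubspace_Un[OF R] by blast
  have "finite C" using B C finite_subset by blast
  then show ?thesis
    using closed_image_of_closed_complement[OF bounded_op_bounded_linear[OF S] subspace_if_csubspace[OF D(1)] D(2)
        subspace_if_csubspace[OF csubspace_cspan] closed_fin_dim[OF fin_dim_cspan] subspace_if_csubspace[OF P(1)] P(2) sum C(3)]
    by blast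
qed

section \<open>Fredholm and B-Fredholm operators from finite ascent and descent\<close>

lemma fredholm_if_fin_codim:
  assumes S: "bounded_op S" and "fin_dim (kernel S)" and cod: "fin_codim_in UNIV (range S)"
  shows "fredholm S"
proof -
  have "closed (range S)"
    by (rule closed_image_of_fin_codim[OF S _ _ _ _ _ cod]) auto
  then show ?thesis using assms by (simp add: fredholm_def fredholm_on_def)
qed

text \<open>\<open>S\<close> maps the kernel of \<open>S ^^ Suc k\<close> into that of
  \<open>S ^^ k\<close>, and loses only a part of \<open>kernel S\<close>.\<close>

lemma fin_dim_kernel_funpow:
  assumes S: "bounded_op S" and ker: "fin_dim (kernel S)"
  shows "fin_dim (kernel (S ^^ k))"
proof (induction k)
  case 0
  then show ?case by (simp add: kernel_def fin_dim_zero)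
next
  case (Suc k)
  let ?K = "kernel (S ^^ Suc k)"
  have K: "complex_vector.subspace ?K" by (intro csubspace_kernel bounded_op_funpow S)
  have "S ` ?K \<subseteq> kernel (S ^^ k)" by (auto simp: kernel_def funpow_swap1)
  then have "fin_dim (S ` ?K)" by (rule fin_dim_mono[OF Suc csubspace_image[OF S K]])
  moreover have "fin_dim (kernel S \<inter> ?K)"
    by (rule fin_dim_mono[OF ker]) (intro complex_vector.subspace_inter csubspace_kernel S K | simp)+
  ultimately show ?case by (rule fin_dim_preimage[OF bounded_op_linear[OF S] K])
qed

text \<open>The space is \<open>range (S ^^ k)\<close> plus the finite-dimensional
  \<open>kernel (S ^^ k)\<close>, and the first summand lies in \<open>range S\<close>.\<close>

lemma fredholm_if_finite_ascent_descent:
  assumes S: "bounded_op S" and fin: "ascent S < \<infinity>" "descent S < \<infinity>" and ker: "fin_dim (kernel S)"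
  shows "fredholm S"
proof -
  obtain k where k: "\<And>x. \<exists>u\<in>kernel (S ^^ k). \<exists>v\<in>range (S ^^ k). x = v + u" "k > 0"
    using finite_ascent_descent_decomposition[OF S fin] by metis
  obtain B where B: "finite B" "cspan B = kernel (S ^^ k)"
    using fin_dim_kernel_funpow[OF S ker] unfolding fin_dim_def by blast
  have "range (S ^^ k) \<subseteq> range S" using range_funpow_antimono[of 1 k S] k(2) by simp
  then have "UNIV \<subseteq> cspan (range S \<union> B)"
    unfolding cspan_csubspace_Un[OF csubspace_image[OF S complex_vector.subspace_UNIV]] B using k(1) by blast
  then show ?thesis
    using B(1) by (intro fredholm_if_fin_codim[OF S ker]) (auto simp: fin_codim_in_def)
qed

text \<open>On \<open>range (S ^^ k)\<close> the operator is bijective, which is more than Fredholm;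
  this range is closed because \<open>kernel (S ^^ k)\<close> is a closed complement.\<close>

lemma b_fredholm_if_finite_ascent_descent:
  assumes S: "bounded_op S" and fin: "ascent S < \<infinity>" "descent S < \<infinity>"
  shows "b_fredholm S"
proof -
  obtain k where k: "kernel (S ^^ k) \<inter> range (S ^^ k) = {0}"
    "\<And>x. \<exists>u\<in>kernel (S ^^ k). \<exists>v\<in>range (S ^^ k). x = v + u"
    "range (S ^^ Suc k) = range (S ^^ k)" "k > 0"
    using finite_ascent_descent_decomposition[OF S fin] by metis
  note Sk = bounded_op_funpow[OF S, of k]
  have cl: "closed (range (S ^^ k))"
  proof (rule closed_image_of_closed_complement)
    show "bounded_linear (S ^^ k)" by (rule bounded_op_bounded_linear[OF Sk])
    show "subspace (kernel (S ^^ k))" by (intro subspace_if_csubspace csubspace_kernel Sk)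
    show "closed (kernel (S ^^ k))" by (rule closed_kernel[OF Sk])
    show "{(S ^^ k) x + y |x y. x \<in> UNIV \<and> y \<in> kernel (S ^^ k)} = UNIV" using k(2) by blast
  qed (use k(1) in auto)
  have im: "S ` range (S ^^ k) = range (S ^^ k)" using k(3) by (simp only: range_funpow_Suc)
  have "kernel S \<subseteq> kernel (S ^^ k)" using kernel_funpow_mono[OF S, of 1 k] k(4) by simp
  then have "kernel S \<inter> range (S ^^ k) \<subseteq> {0}" using k(1) by blast
  moreover have "0 \<in> kernel S \<inter> range (S ^^ k)"
    using complex_vector.subspace_0[OF csubspace_kernel[OF S]] complex_vector.subspace_0[OF csubspace_range_funpow[OF S]] by blast
  ultimately have "kernel S \<inter> range (S ^^ k) = {0}" by blast
  then have "fredholm_on (range (S ^^ k)) S"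
    unfolding fredholm_on_def im using subset_cspan[of "range (S ^^ k)"]
    by (auto simp: fin_dim_zero fin_codim_in_def intro!: exI[of _ "{}"])
  with cl show ?thesis unfolding b_fredholm_def by blast
qed

lemma invertible_op_finite_ascent_descent:
  assumes "invertible_op S"
  shows "ascent S < \<infinity>" "descent S < \<infinity>"
proof -
  obtain R where R: "bounded_op R" "R \<circ> S = id" "S \<circ> R = id"
    using assms unfolding invertible_op_def by (elim exE conjE)
  have RS: "R (S x) = x" and SR: "S (R x) = x" for x
    using fun_cong[OF R(2), of x] fun_cong[OF R(3), of x] by simp_all
  have S0: "S 0 = 0" using SR[of 0] bounded_op_zero[OF R(1)] by simp
  have ker: "kernel S = {0}"
    using RS bounded_op_zero[OF R(1)] S0 unfolding kernel_def by (metis (mono_tags, lifting) Collect_cong singleton_conv)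
  have "kernel (S ^^ 0) = kernel (S ^^ Suc 0)" using ker by (auto simp: kernel_def)
  then show "ascent S < \<infinity>" unfolding ascent_finite_iff by blast
  have "range (S ^^ 0) = range (S ^^ Suc 0)" using surjI[of S R] SR by simp
  then show "descent S < \<infinity>" unfolding descent_finite_iff by blast
qed

section \<open>Perturbation of B-Fredholm operators\<close>

lemma fredholm_on_range_funpow:
  assumes T: "bounded_op T" and cl: "closed (range (T ^^ n))" and fr: "fredholm_on (range (T ^^ n)) T"
    and "n \<le> k"
  shows "closed (range (T ^^ k)) \<and> fredholm_on (range (T ^^ k)) T"
  using \<open>n \<le> k\<close>
proof (induction k rule: dec_induct)
  case base
  then show ?case using cl fr by blast
next
  case (step k)
  let ?M = "range (T ^^ k)" and ?M' = "range (T ^^ Suc k)"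
  interpret T: Vector_Spaces.linear scaleC scaleC T by (rule bounded_op_linear[OF T])
  have M': "?M' = T ` ?M" by (rule range_funpow_Suc)
  have sub: "?M' \<subseteq> ?M" by (rule range_funpow_antimono) simp
  have cs: "complex_vector.subspace ?M" "complex_vector.subspace ?M'" by (rule csubspace_range_funpow[OF T])+
  have "closedin (top_of_set ?M) ?M'" "closed ?M" "fin_dim (kernel T \<inter> ?M)" "fin_codim_in ?M ?M'"
    using step.IH unfolding fredholm_on_def M' by blast+
  then have cl': "closed ?M'" using closedin_closed_trans by blast
  have "fin_dim (kernel T \<inter> ?M')"
    by (rule fin_dim_mono[OF \<open>fin_dim (kernel T \<inter> ?M)\<close>])
      (use sub in \<open>auto intro!: complex_vector.subspace_inter csubspace_kernel[OF T] cs(2) simp del: funpow.simps\<close>)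
  moreover have cod: "fin_codim_in ?M' (T ` ?M')"
  proof -
    obtain B where B: "finite B" "B \<subseteq> ?M" "?M \<subseteq> cspan (?M' \<union> B)"
      using \<open>fin_codim_in ?M ?M'\<close> unfolding fin_codim_in_def by blast
    have "T ` ?M \<subseteq> T ` cspan (?M' \<union> B)" using B(3) by (rule image_mono)
    also have "\<dots> = cspan (T ` ?M' \<union> T ` B)" unfolding cspan_def T.span_image[symmetric] image_Un ..
    finally have "?M' \<subseteq> cspan (T ` ?M' \<union> T ` B)" unfolding M' .
    moreover have "T ` B \<subseteq> ?M'" unfolding M' using B(2) by (rule image_mono)
    ultimately show ?thesis unfolding fin_codim_in_def using B(1) by blast
  qed
  moreover have "T ` ?M' \<subseteq> ?M'"
    using range_funpow_antimono[of "Suc k" "Suc (Suc k)" T] unfolding range_funpow_Suc[of "Suc k"] by simp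
  then have "closed (T ` ?M')"
    by (intro closed_image_of_fin_codim[OF T cs(2) cl' cs(2) cl' _ cod])
  then have "closedin (top_of_set ?M') (T ` ?M')"
    using \<open>T ` ?M' \<subseteq> ?M'\<close> by (rule closed_subset[rotated])
  ultimately show ?case using cl' unfolding fredholm_on_def by blast
qed

text \<open>Since \<open>z x = T x - (T - z) x\<close>, membership of \<open>x\<close> climbs from
  one range to the next. In particular every range contains the kernel of
  \<open>shift T z\<close>.\<close>

lemma shift_preimage_in_range_funpow:
  assumes T: "bounded_op T" and z: "z \<noteq> 0" and x: "shift T z x \<in> range (T ^^ k)"
  shows "x \<in> range (T ^^ k)"
proof -
  have "x \<in> range (T ^^ j)" if "j \<le> k" for j
    using that
  proof (induction j)
    case (Suc j)
    have cs: "complex_vector.subspace (range (T ^^ Suc j))" by (rule csubspace_range_funpow[OF T])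
    have "T x \<in> range (T ^^ Suc j)" unfolding range_funpow_Suc using Suc by simp
    moreover have "shift T z x \<in> range (T ^^ Suc j)"
      using subsetD[OF range_funpow_antimono[OF Suc.prems] x] .
    ultimately have "T x - shift T z x \<in> range (T ^^ Suc j)" by (rule complex_vector.subspace_diff[OF cs])
    then have "scaleC (1 / z) (T x - shift T z x) \<in> range (T ^^ Suc j)"
      by (rule complex_vector.subspace_scale[OF cs])
    moreover have "scaleC (1 / z) (T x - shift T z x) = x"
      using z by (simp add: shift_def scaleC_scaleC scaleC_one)
    ultimately show ?case by (simp only:)
  qed simp
  then show ?thesis by blast
qed

text \<open>The identity \<open>v = (T - z) (- v / z) + T v / z\<close> pushes the remainder
  \<open>v\<close> one range further.\<close>

lemma shift_range_plus_range_funpow: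
  assumes T: "bounded_op T" and z: "z \<noteq> 0"
  shows "\<exists>u. \<exists>v\<in>range (T ^^ k). x = shift T z u + v"
proof (induction k)
  case 0
  show ?case using bounded_op_zero[OF bounded_op_shift[OF T]] by (intro exI[of _ 0]) auto
next
  case (Suc k)
  interpret S: Vector_Spaces.linear scaleC scaleC "shift T z" by (rule bounded_op_linear[OF bounded_op_shift[OF T]])
  obtain u v where uv: "v \<in> range (T ^^ k)" "x = shift T z u + v" using Suc by blast
  have "T v \<in> range (T ^^ Suc k)" unfolding range_funpow_Suc using uv by blast
  then have "scaleC (1 / z) (T v) \<in> range (T ^^ Suc k)"
    by (rule complex_vector.subspace_scale[OF csubspace_range_funpow[OF T]])
  moreover have "v = shift T z (- scaleC (1 / z) v) + scaleC (1 / z) (T v)"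
    unfolding S.neg S.scale using z
    by (simp add: shift_def complex_vector.scale_right_diff_distrib scaleC_scaleC scaleC_one)
  then have "x = shift T z (u + - scaleC (1 / z) v) + scaleC (1 / z) (T v)"
    unfolding S.add using uv(2) by (simp add: add.assoc)
  ultimately show ?case by blast
qed

lemma fredholm_shift_near_b_fredholm:
  assumes T: "bounded_op T" and cl: "closed (range (T ^^ n))" and fr: "fredholm_on (range (T ^^ n)) T"
  obtains \<delta> where "\<delta> > 0" "\<And>z. z \<noteq> 0 \<Longrightarrow> cmod z < \<delta> \<Longrightarrow> fredholm (shift T z)"
proof -
  let ?M = "range (T ^^ n)"
  have M: "complex_vector.subspace ?M" by (rule csubspace_range_funpow[OF T])
  note rM = subspace_if_csubspace[OF M] and blT = bounded_op_bounded_linear[OF T]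
  have TM: "T ` ?M \<subseteq> ?M" using range_funpow_antimono[of n "Suc n" T] unfolding range_funpow_Suc by simp
  have clT: "closed (T ` ?M)" and ker: "fin_dim (kernel T \<inter> ?M)" and cod: "fin_codim_in ?M (T ` ?M)"
    using fr cl closedin_closed_trans unfolding fredholm_on_def by blast+
  have csTM: "complex_vector.subspace (T ` ?M)" by (rule csubspace_image[OF T M])
  obtain B where B: "finite B" "B \<subseteq> ?M" "?M \<subseteq> cspan (T ` ?M \<union> B)" using cod unfolding fin_codim_in_def by blast
  let ?F = "cspan B"
  have F: "complex_vector.subspace ?F" "closed ?F" "?F \<subseteq> ?M"
    by (rule csubspace_cspan closed_fin_dim fin_dim_cspan B cspan_minimal M)+
  note rF = subspace_if_csubspace[OF F(1)]
  \<comment> \<open>Adding the finite-dimensional \<open>?F\<close> makes \<open>T\<close> onto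
    \<open>?M\<close>, and surjectivity survives small perturbations.\<close>
  let ?g = "\<lambda>p::'a \<times> 'a. T (fst p) + snd p"
  have g: "bounded_linear ?g"
    by (intro bounded_linear_add bounded_linear_compose[OF blT] bounded_linear_fst bounded_linear_snd)
  have gM: "?g ` (?M \<times> ?F) = ?M"
  proof (intro equalityI subsetI)
    fix y assume "y \<in> ?g ` (?M \<times> ?F)"
    then obtain a b where ab: "a \<in> ?M" "b \<in> ?F" "y = T a + b" by (clarsimp simp del: image_iff) auto
    then show "y \<in> ?M" using complex_vector.subspace_add[OF M, of "T a" b] TM F(3) by blast
  next
    fix y assume "y \<in> ?M"
    then have "y \<in> cspan (T ` ?M \<union> B)" using B(3) by blast
    then obtain r b where "r \<in> T ` ?M" "b \<in> ?F" "y = r + b" unfolding cspan_csubspace_Un[OF csTM] by blast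
    then obtain a where "a \<in> ?M" "y = T a + b" by blast
    then show "y \<in> ?g ` (?M \<times> ?F)" using \<open>b \<in> ?F\<close> by (intro image_eqI[of _ _ "(a, b)"]) auto
  qed
  obtain C1 where C1: "C1 > 0" "\<And>y. y \<in> ?M \<Longrightarrow> \<exists>p\<in>?M \<times> ?F. ?g p = y \<and> norm p \<le> C1 * norm y"
    using open_mapping_bound[OF g subspace_Times[OF rM rF] closed_Times[OF cl F(2)] rM cl gM] by blast
  obtain C2 where C2: "C2 > 0" "\<And>y. y \<in> T ` ?M \<Longrightarrow> \<exists>x\<in>?M. T x = y \<and> norm x \<le> C2 * norm y"
    using open_mapping_bound[OF blT rM cl subspace_if_csubspace[OF csTM] clT refl] by blast
  \<comment> \<open>The first bound serves \<open>surj_perturbation\<close>, the second the factor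
    1/8 in \<open>fin_dim_if_near_fin_dim\<close>.\<close>
  define \<delta> where "\<delta> = min (1 / (2 * C1)) (1 / (8 * C2))"
  have "\<delta> > 0" using C1 C2 by (simp add: \<delta>_def)
  moreover have "fredholm (shift T z)" if z: "z \<noteq> 0" "cmod z < \<delta>" for z
  proof (rule fredholm_if_fin_codim)
    show S: "bounded_op (shift T z)" by (rule bounded_op_shift[OF T])
    have z1: "cmod z * C1 \<le> 1/2" and z2: "cmod z * C2 \<le> 1/8"
      using z C1(1) C2(1) by (simp_all add: \<delta>_def field_simps)
    show "fin_dim (kernel (shift T z))"
    proof (rule fin_dim_if_near_fin_dim[OF csubspace_kernel[OF S] ker])
      fix x assume x: "x \<in> kernel (shift T z)"
      then have Tx: "T x = scaleC z x" and "shift T z x \<in> ?M"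
        using complex_vector.subspace_0[OF M] by (simp_all add: kernel_def shift_def)
      then have xM: "x \<in> ?M" using shift_preimage_in_range_funpow[OF T z(1)] by blast
      \<comment> \<open>A short preimage \<open>w\<close> of \<open>T x = z x\<close>: then
        \<open>x - w\<close> lies in the kernel of \<open>T\<close> within \<open>norm x / 8\<close>
        of \<open>x\<close>.\<close>
      then obtain w where w: "w \<in> ?M" "T w = T x" "norm w \<le> C2 * norm (T x)" using C2(2) by blast
      have "norm w \<le> (cmod z * C2) * norm x" using w(3) by (simp add: Tx norm_scaleC mult_ac)
      also have "\<dots> \<le> 1/8 * norm x" using z2 by (rule mult_right_mono) simp
      finally have "norm (x - (x - w)) \<le> norm x / 8" by simp
      moreover have "x - w \<in> kernel T \<inter> ?M"
        using complex_vector.subspace_diff[OF M xM w(1)] w(2) linear_diff[OF bounded_linear.linear[OF blT], of x w]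
        by (simp add: kernel_def)
      ultimately show "\<exists>y\<in>kernel T \<inter> ?M. norm (x - y) \<le> norm x / 8" by blast
    qed
    show "fin_codim_in UNIV (range (shift T z))"
    proof -
      have csR: "complex_vector.subspace (range (shift T z))"
        by (rule csubspace_image[OF S complex_vector.subspace_UNIV])
      have "x \<in> cspan (range (shift T z) \<union> B)" for x
      proof -
        obtain u v where uv: "v \<in> ?M" "x = shift T z u + v"
          using shift_range_plus_range_funpow[OF T z(1)] by blast
        have "\<exists>p\<in>?M \<times> ?F. ?g p - scaleC z (fst p) = v \<and> norm p \<le> 2 * C1 * norm v"
        proof (rule surj_perturbation[OF g _ subspace_Times[OF rM rF] closed_Times[OF cl F(2)] rM _ _ C1(2)])
          show "bounded_linear (\<lambda>p::'a \<times> 'a. scaleC z (fst p))"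
            by (rule bounded_linear_compose[OF bounded_linear_scaleC bounded_linear_fst])
          show "?g ` (?M \<times> ?F) \<subseteq> ?M" using gM by blast
          show "(\<lambda>p. scaleC z (fst p)) ` (?M \<times> ?F) \<subseteq> ?M" using complex_vector.subspace_scale[OF M] by auto
          show "norm (scaleC z (fst p)) \<le> cmod z * norm p" for p :: "'a \<times> 'a"
            unfolding norm_scaleC using norm_fst_le[of "fst p" "snd p"] by (intro mult_left_mono) auto
        qed (use z1 uv in auto)
        then obtain a b where ab: "b \<in> ?F" "T a + b - scaleC z a = v" by (auto simp del: image_iff)
        then have "v = shift T z a + b" by (simp add: shift_def algebra_simps)
        then have "x = (shift T z u + shift T z a) + b" using uv(2) by (simp add: add.assoc)
        moreover have "shift T z u + shift T z a \<in> range (shift T z)"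
          by (rule complex_vector.subspace_add[OF csR]) auto
        ultimately show ?thesis unfolding cspan_csubspace_Un[OF csR] using ab(1) by blast
      qed
      then show ?thesis unfolding fin_codim_in_def using B(1) by blast
    qed
  qed
  ultimately show ?thesis using that by blast
qed

section \<open>Transfer of finite ascent and descent from nearby shifts\<close>

lemma injective_if_surj_on_finite_ascent:
  assumes S: "bounded_op S" and surj: "Y \<subseteq> S ` Y" and asc: "ascent S < \<infinity>" and x: "x \<in> Y" "S x = 0"
  shows "x = 0"
proof -
  obtain n where n: "kernel (S ^^ n) = kernel (S ^^ Suc n)" using asc unfolding ascent_finite_iff by blast
  have "Y \<subseteq> (S ^^ k) ` Y" for k
  proof (induction k)
    case (Suc k)
    have "Y \<subseteq> S ` Y" by (rule surj)
    also have "\<dots> \<subseteq> S ` ((S ^^ k) ` Y)" using Suc by (rule image_mono)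
    finally show ?case by (simp add: image_comp)
  qed simp
  \<comment> \<open>Pulling \<open>x\<close> back \<open>n\<close> times inside \<open>Y\<close>
    gives a vector killed by \<open>S ^^ Suc n\<close>, hence by \<open>S ^^ n\<close>, which sends
    it to \<open>x\<close>.\<close>
  then obtain y where y: "y \<in> Y" "x = (S ^^ n) y" using x(1) by blast
  then have "y \<in> kernel (S ^^ Suc n)" using x(2) by (simp add: kernel_def)
  then have "y \<in> kernel (S ^^ n)" by (simp only: n)
  then show ?thesis using y(2) by (simp add: kernel_def)
qed

lemma surj_if_inj_finite_descent:
  assumes S: "inj S" and desc: "descent S < \<infinity>"
  shows "surj S"
proof -
  obtain n where n: "range (S ^^ n) = range (S ^^ Suc n)" using desc unfolding descent_finite_iff by blast
  have inj: "inj (S ^^ n)" using S by (rule inj_fn)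
  have "x \<in> range S" for x
  proof -
    have "(S ^^ n) x \<in> range (S ^^ Suc n)" using n by blast
    then obtain y where "(S ^^ n) x = (S ^^ n) (S y)" by (auto simp: funpow_swap1)
    then have "x = S y" using inj by (simp add: inj_eq)
    then show ?thesis by blast
  qed
  then show ?thesis by blast
qed

lemma kernel_Int_range_trivial_if_finite_ascent_near:
  assumes T: "bounded_op T" and cl: "closed (range (T ^^ n))" and fr: "fredholm_on (range (T ^^ n)) T"
    and \<delta>: "\<delta> > 0" and asc: "\<And>z. z \<noteq> 0 \<Longrightarrow> cmod z < \<delta> \<Longrightarrow> ascent (shift T z) < \<infinity>"
  obtains k where "k \<ge> n" "kernel T \<inter> range (T ^^ k) = {0}"
proof -
  let ?M = "\<lambda>k. range (T ^^ k)"
  note blT = bounded_op_bounded_linear[OF T]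
  note fk = fredholm_on_range_funpow[OF T cl fr]
  have M: "complex_vector.subspace (?M k)" for k by (rule csubspace_range_funpow[OF T])
  have csN: "complex_vector.subspace (kernel T \<inter> ?M k)" for k
    by (rule complex_vector.subspace_inter[OF csubspace_kernel[OF T] M])
  have "kernel T \<inter> ?M (Suc k) \<subseteq> kernel T \<inter> ?M k" for k
    using range_funpow_antimono[of k "Suc k" T] by auto
  moreover have "fin_dim (kernel T \<inter> ?M n)" using fr by (simp add: fredholm_on_def)
  ultimately obtain m where m: "m \<ge> n" "\<And>k. k \<ge> m \<Longrightarrow> kernel T \<inter> ?M k = kernel T \<inter> ?M m"
    using fin_dim_decseq_stabilises[of "\<lambda>k. kernel T \<inter> ?M k" n] csN by blast
  \<comment> \<open>Starting at \<open>n\<close> makes every member closed; as the ranges decrease,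
    \<open>Y\<close> is still the intersection of all of them.\<close>
  define Y where "Y = (\<Inter>k\<in>{n..}. ?M k)"
  have Y_if: "x \<in> Y" if "\<And>k. k \<ge> m \<Longrightarrow> x \<in> ?M k" for x
  proof -
    have "x \<in> ?M k" for k
      using that[of "max k m"] range_funpow_antimono[of k "max k m" T] by auto
    then show ?thesis unfolding Y_def by blast
  qed
  have YM: "Y \<subseteq> ?M k" for k
  proof -
    have "Y \<subseteq> ?M (max k n)" unfolding Y_def by (rule INT_lower) simp
    also have "\<dots> \<subseteq> ?M k" by (rule range_funpow_antimono) simp
    finally show ?thesis .
  qed
  have Y: "complex_vector.subspace Y" "closed Y"
    unfolding Y_def using M fk by (auto intro!: complex_vector.subspace_Inter closed_INT simp del: image_iff)
  note rY = subspace_if_csubspace[OF Y(1)]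
  have NY: "kernel T \<inter> ?M m \<subseteq> Y"
    using m(2) Y_if by blast
  have TY: "T ` Y = Y"
  proof (intro equalityI subsetI)
    fix y assume "y \<in> T ` Y"
    then obtain x where x: "x \<in> Y" "y = T x" by blast
    have "y \<in> ?M k" for k
    proof -
      have "y \<in> ?M (Suc k)" unfolding range_funpow_Suc using x YM by blast
      then show ?thesis using range_funpow_antimono[of k "Suc k" T] by auto
    qed
    then show "y \<in> Y" using Y_if by blast
  next
    fix y assume y: "y \<in> Y"
    have "\<exists>x\<in>?M k. T x = y" for k using y YM[of "Suc k"] unfolding range_funpow_Suc by blast
    then obtain x where x: "\<And>k. x k \<in> ?M k" "\<And>k. T (x k) = y" by metis
    \<comment> \<open>The preimages \<open>x m\<close> and \<open>x k\<close> of \<open>y\<close>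
      differ by a kernel vector in \<open>?M m\<close>; since the kernels have stabilised, it lies
      in \<open>Y\<close>, so \<open>x m\<close> belongs to \<open>?M k\<close> as
      \<open>x k\<close> does.\<close>
    have "x m \<in> ?M k" if "k \<ge> m" for k
    proof -
      have "x k \<in> ?M m" using x(1)[of k] range_funpow_antimono[OF that, of T] by blast
      then have "x m - x k \<in> kernel T \<inter> ?M m"
        using complex_vector.subspace_diff[OF M x(1)] x(2) linear_diff[OF bounded_linear.linear[OF blT]]
        by (simp add: kernel_def)
      then have "x m - x k \<in> ?M k" using NY YM by blast
      then have "x m - x k + x k \<in> ?M k" by (rule complex_vector.subspace_add[OF M _ x(1)])
      then show ?thesis by simp
    qed
    then have "x m \<in> Y" by (rule Y_if)
    then show "y \<in> T ` Y" using x(2)[of m] by blast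
  qed
  obtain C where C: "C > 0" "\<And>y. y \<in> Y \<Longrightarrow> \<exists>x\<in>Y. T x = y \<and> norm x \<le> C * norm y"
    using open_mapping_bound[OF blT rY Y(2) rY Y(2) TY] by blast
  have "x = 0" if x: "x \<in> kernel T \<inter> ?M m" for x
  proof (rule ccontr)
    assume "x \<noteq> 0"
    define r where "r = min (\<delta> / 2) (1 / (4 * C))"
    define z where "z = complex_of_real r"
    have r: "r > 0" "r < \<delta>" "r * C \<le> 1/4" using C(1) \<delta> by (auto simp: r_def field_simps min_def)
    then have z: "z \<noteq> 0" "cmod z < \<delta>" "cmod z = r" by (simp_all add: z_def)
    have S: "bounded_op (shift T z)" by (rule bounded_op_shift[OF T])
    have surj: "\<exists>x\<in>Y. T x - scaleC z x = y \<and> norm x \<le> 2 * C * norm y" if "y \<in> Y" for y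
    proof (rule surj_perturbation[OF blT bounded_linear_scaleC rY Y(2) rY _ _ C(2)])
      show "T ` Y \<subseteq> Y" using TY by blast
      show "scaleC z ` Y \<subseteq> Y" using complex_vector.subspace_scale[OF Y(1)] by blast
      show "norm (scaleC z x) \<le> cmod z * norm x" for x :: 'a by (simp add: norm_scaleC)
      show "cmod z * C \<le> 1/2" using r z by simp
    qed (use that in auto)
    have xY: "x \<in> Y" using x NY by blast
    \<comment> \<open>As \<open>T x = 0\<close>, \<open>- z x\<close> is the value of
      \<open>T - z\<close> at \<open>x\<close>. A second preimage \<open>w\<close> of norm at most
      \<open>norm x / 2\<close>, thanks to \<open>r * C \<le> 1/4\<close>, makes
      \<open>x - w\<close> a nonzero kernel vector.\<close>
    have "scaleC (- z) x \<in> Y" by (rule complex_vector.subspace_scale[OF Y(1) xY])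
    then obtain w where w: "w \<in> Y" "T w - scaleC z w = scaleC (- z) x" "norm w \<le> 2 * C * norm (scaleC (- z) x)"
      using surj by blast
    have "norm w \<le> 2 * (r * C) * norm x" using w(3) z by (simp add: norm_scaleC mult_ac)
    also have "\<dots> \<le> 2 * (1/4) * norm x" using r(3) by (intro mult_right_mono mult_left_mono) auto
    also have "\<dots> < norm x" using \<open>x \<noteq> 0\<close> by simp
    finally have "x - w \<noteq> 0" by auto
    moreover have "x - w \<in> Y" by (rule complex_vector.subspace_diff[OF Y(1) xY w(1)])
    moreover have "shift T z (x - w) = 0"
      using w(2) x linear_diff[OF bounded_linear.linear[OF blT], of x w]
      by (simp add: shift_def kernel_def complex_vector.scale_right_diff_distrib algebra_simps)
    moreover have "Y \<subseteq> shift T z ` Y" using surj unfolding shift_def by blast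
    ultimately show False
      using injective_if_surj_on_finite_ascent[OF S _ asc[OF z(1,2)]] by blast
  qed
  then have "kernel T \<inter> ?M m = {0}" using complex_vector.subspace_0[OF csN] by blast
  then show ?thesis using that m(1) by blast
qed

lemma finite_descent_if_finite_descent_near:
  assumes T: "bounded_op T" and cl: "closed (range (T ^^ k))" "closed (range (T ^^ Suc k))"
    and ker: "kernel T \<inter> range (T ^^ k) = {0}"
    and \<delta>: "\<delta> > 0" and desc: "\<And>z. z \<noteq> 0 \<Longrightarrow> cmod z < \<delta> \<Longrightarrow> descent (shift T z) < \<infinity>"
  shows "range (T ^^ k) = range (T ^^ Suc k)"
proof -
  let ?M = "range (T ^^ k)"
  note blT = bounded_op_bounded_linear[OF T]
  have M: "complex_vector.subspace ?M" by (rule csubspace_range_funpow[OF T])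
  note rM = subspace_if_csubspace[OF M]
  have clT: "closed (T ` ?M)" using cl(2) unfolding range_funpow_Suc .
  obtain C where C: "C > 0" "\<And>y. y \<in> T ` ?M \<Longrightarrow> \<exists>x\<in>?M. T x = y \<and> norm x \<le> C * norm y"
    using open_mapping_bound[OF blT rM cl(1) subspace_if_csubspace[OF csubspace_image[OF T M]] clT refl] by blast
  \<comment> \<open>The bounded preimage of \<open>T x\<close> is \<open>x\<close> itself, because
    the kernel meets \<open>?M\<close> trivially.\<close>
  have below: "norm x \<le> C * norm (T x)" if x: "x \<in> ?M" for x
  proof -
    obtain w where w: "w \<in> ?M" "T w = T x" "norm w \<le> C * norm (T x)" using C(2) x by blast
    have "x - w \<in> kernel T \<inter> ?M"
      using complex_vector.subspace_diff[OF M x w(1)] w(2) linear_diff[OF bounded_linear.linear[OF blT], of x w]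
      by (simp add: kernel_def)
    then show ?thesis using ker w(3) by auto
  qed
  have below': "norm x \<le> 2 * C * norm (shift T z x)" if x: "x \<in> ?M" and z: "cmod z * C \<le> 1/2" for x z
  proof -
    have "norm (T x) \<le> norm (shift T z x) + cmod z * norm x"
      using norm_triangle_ineq[of "shift T z x" "scaleC z x"] by (simp add: shift_def norm_scaleC)
    then have "C * norm (T x) \<le> C * norm (shift T z x) + (cmod z * C) * norm x"
      using mult_left_mono[of "norm (T x)" "norm (shift T z x) + cmod z * norm x" C] C(1)
      by (simp add: algebra_simps)
    moreover have "(cmod z * C) * norm x \<le> 1/2 * norm x" using z by (rule mult_right_mono) simp
    ultimately show ?thesis using below[OF x] by simp
  qed
  have "y \<in> T ` ?M" if y: "y \<in> ?M" for y
  proof -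
    have "y \<in> closure (T ` ?M)" unfolding closure_approachable
    proof (intro allI impI)
      fix e :: real assume e: "e > 0"
      \<comment> \<open>The three bounds keep \<open>z\<close> within \<open>\<delta>\<close>, make
        \<open>below'\<close> applicable, and bring \<open>r * norm x\<close> to at most
        \<open>e / 2\<close>. The \<open>+ 1\<close> avoids division by zero when
        \<open>y = 0\<close>.\<close>
      define r where "r = min (\<delta> / 2) (min (1 / (2 * C)) (e / (2 * (2 * C * norm y + 1))))"
      define z where "z = complex_of_real r"
      have D: "2 * C * norm y + 1 > 0" using C(1) by (simp add: add_nonneg_pos)
      have r: "r > 0" "r < \<delta>" "r \<le> 1 / (2 * C)" "r \<le> e / (2 * (2 * C * norm y + 1))"
        using C(1) \<delta> e D by (auto simp: r_def)
      then have z: "z \<noteq> 0" "cmod z < \<delta>" "cmod z = r" by (simp_all add: z_def)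
      have zC: "cmod z * C \<le> 1/2" using r(3) C(1) z(3) by (simp add: field_simps)
      have S: "bounded_op (shift T z)" by (rule bounded_op_shift[OF T])
      interpret S: Vector_Spaces.linear scaleC scaleC "shift T z" by (rule bounded_op_linear[OF S])
      have inj: "inj (shift T z)"
      proof (rule injI)
        fix a b assume "shift T z a = shift T z b"
        then have 0: "shift T z (a - b) = 0" by (simp add: S.diff)
        \<comment> \<open>Kernel vectors of the shift lie in \<open>?M\<close>, so the lower bound
          there gives injectivity on the whole space.\<close>
        then have "a - b \<in> ?M"
          using shift_preimage_in_range_funpow[OF T z(1)] complex_vector.subspace_0[OF M] by metis
        then show "a = b" using below'[OF _ zC, of "a - b"] 0 by simp
      qed
      obtain x where x: "y = shift T z x"
        using surj_if_inj_finite_descent[OF inj desc[OF z(1,2)]] by blast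
      then have xM: "x \<in> ?M" using shift_preimage_in_range_funpow[OF T z(1)] y by metis
      have "dist (T x) y = r * norm x" using z by (simp add: x shift_def dist_norm norm_scaleC)
      also have "\<dots> \<le> r * (2 * C * norm y + 1)" using below'[OF xM zC] r(1) x by (intro mult_left_mono) auto
      also have "\<dots> \<le> e / 2" using r(4) D by (simp add: field_simps)
      also have "\<dots> < e" using e by simp
      finally show "\<exists>w\<in>T ` ?M. dist w y < e" using xM by blast
    qed
    then show ?thesis using clT by simp
  qed
  then have "?M \<subseteq> range (T ^^ Suc k)" unfolding range_funpow_Suc by blast
  then show ?thesis using range_funpow_antimono[of k "Suc k" T] by auto
qed

section \<open>From B-Fredholm shifts to the two equivalences\<close>

lemma shift_shift: "shift (shift T a) b = shift T (a + b)"
  by (simp add: shift_def scaleC_add_left fun_eq_iff algebra_simps)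

lemma finite_ascent_descent_if_b_fredholm:
  assumes S: "bounded_op S" and bf: "b_fredholm S"
    and H: "\<And>z. fredholm (shift S z) \<Longrightarrow> ascent (shift S z) < \<infinity> \<and> descent (shift S z) < \<infinity>"
  shows "ascent S < \<infinity>" "descent S < \<infinity>"
proof -
  obtain n where n: "closed (range (S ^^ n))" "fredholm_on (range (S ^^ n)) S" using bf unfolding b_fredholm_def by blast
  obtain \<delta> where \<delta>: "\<delta> > 0" "\<And>z. z \<noteq> 0 \<Longrightarrow> cmod z < \<delta> \<Longrightarrow> fredholm (shift S z)"
    using fredholm_shift_near_b_fredholm[OF S n] by blast
  obtain k where k: "k \<ge> n" "kernel S \<inter> range (S ^^ k) = {0}"
    using kernel_Int_range_trivial_if_finite_ascent_near[OF S n \<delta>(1)] H \<delta>(2) by blast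
  \<comment> \<open>If \<open>S ^^ Suc k\<close> kills \<open>x\<close>, then
    \<open>(S ^^ k) x\<close> lies in the trivial intersection of \<open>kernel S\<close> with
    \<open>range (S ^^ k)\<close>.\<close>
  have "kernel (S ^^ Suc k) \<subseteq> kernel (S ^^ k)"
  proof
    fix x assume "x \<in> kernel (S ^^ Suc k)"
    then have "(S ^^ k) x \<in> kernel S \<inter> range (S ^^ k)" by (simp add: kernel_def)
    then show "x \<in> kernel (S ^^ k)" unfolding k(2) by (simp add: kernel_def)
  qed
  then have "kernel (S ^^ k) = kernel (S ^^ Suc k)" using kernel_funpow_mono[OF S, of k "Suc k"] by auto
  then show "ascent S < \<infinity>" unfolding ascent_finite_iff by blast
  have "closed (range (S ^^ k))" "closed (range (S ^^ Suc k))"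
    using fredholm_on_range_funpow[OF S n] k(1) le_SucI by blast+
  then have "range (S ^^ k) = range (S ^^ Suc k)"
    using H \<delta> by (intro finite_descent_if_finite_descent_near[OF S _ _ k(2) \<delta>(1)]) auto
  then show "descent S < \<infinity>" unfolding descent_finite_iff by blast
qed

theorem theorem2p4:
  fixes T :: "'a::complex_banach_space \<Rightarrow> 'a"
  assumes inf_dim: "\<not> fin_dim (UNIV :: 'a set)"
    and T: "bounded_op T"
  shows "(class_Be T \<longleftrightarrow> class_gBe T) \<and> (spec_e T = spec_b T \<longleftrightarrow> spec_bf T = spec_d T)"
proof -
  \<comment> \<open>With these predicates all four conditions become pointwise: the classical ones
    say that \<open>F\<close> implies \<open>P\<close>, the generalised ones that \<open>G\<close>
    implies \<open>P\<close>.\<close>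
  define F where "F z \<longleftrightarrow> fredholm (shift T z)" for z
  define G where "G z \<longleftrightarrow> b_fredholm (shift T z)" for z
  define P where "P z \<longleftrightarrow> ascent (shift T z) < \<infinity> \<and> descent (shift T z) < \<infinity>" for z
  define K where "K z \<longleftrightarrow> fin_dim (kernel (shift T z))" for z
  note S = bounded_op_shift[OF T]
  have FK: "F z \<Longrightarrow> K z" for z by (simp add: F_def K_def fredholm_def fredholm_on_def)
  have PKF: "P z \<Longrightarrow> K z \<Longrightarrow> F z" for z
    unfolding P_def K_def F_def using fredholm_if_finite_ascent_descent[OF S] by blast
  have PG: "P z \<Longrightarrow> G z" for z unfolding P_def G_def using b_fredholm_if_finite_ascent_descent[OF S] by blast
  have inv: "z \<notin> spec T \<Longrightarrow> P z" for z
    unfolding P_def spec_def using invertible_op_finite_ascent_descent[of "shift T z"] by blast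
  have FG: "F z \<Longrightarrow> G z" for z
    unfolding F_def G_def fredholm_def b_fredholm_def by (intro exI[of _ 0]) simp
  have "(\<forall>z. F z \<longrightarrow> P z) \<longleftrightarrow> (\<forall>z. G z \<longrightarrow> P z)"
  proof
    assume H: "\<forall>z. F z \<longrightarrow> P z"
    show "\<forall>z. G z \<longrightarrow> P z"
    proof (intro allI impI)
      fix z assume "G z"
      \<comment> \<open>The criterion is applied to \<open>shift T z\<close>; its shifts are again
        shifts of \<open>T\<close>, so \<open>H\<close> covers them.\<close>
      then show "P z" unfolding P_def G_def
        using finite_ascent_descent_if_b_fredholm[OF S, of z] H unfolding F_def P_def shift_shift by blast
    qed
  qed (use FG in blast)
  moreover have "class_Be T \<longleftrightarrow> (\<forall>z. F z \<longrightarrow> P z)"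
  proof -
    \<comment> \<open>Outside the spectrum \<open>P\<close> holds anyway; inside it,
      \<open>P\<close> and \<open>K\<close> give \<open>F\<close>, and \<open>F\<close> gives
      \<open>K\<close>, so only \<open>F\<close> implies \<open>P\<close> is left.\<close>
    have "class_Be T \<longleftrightarrow> (\<forall>z. z \<in> spec T \<longrightarrow> (F z \<longleftrightarrow> P z \<and> K z))"
      unfolding class_Be_def spec_e_def poles0_def poles_def F_def P_def K_def by blast
    then show ?thesis using FK PKF inv by blast
  qed
  moreover have "class_gBe T \<longleftrightarrow> (\<forall>z. G z \<longrightarrow> P z)"
  proof -
    have "class_gBe T \<longleftrightarrow> (\<forall>z. z \<in> spec T \<longrightarrow> (G z \<longleftrightarrow> P z))"
      unfolding class_gBe_def spec_bf_def poles_def G_def P_def by blast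
    then show ?thesis using PG inv by blast
  qed
  moreover have "spec_e T = spec_b T \<longleftrightarrow> (\<forall>z. F z \<longrightarrow> P z)"
    unfolding spec_e_def spec_b_def browder_def F_def P_def by blast
  moreover have "spec_bf T = spec_d T \<longleftrightarrow> (\<forall>z. G z \<longrightarrow> P z)"
  proof -
    have "spec_d T = {z. \<not> P z}" by (auto simp: spec_d_def P_def)
    moreover have "spec_bf T = {z. \<not> G z}" by (simp add: spec_bf_def G_def)
    ultimately show ?thesis using PG by blast
  qed
  ultimately show ?thesis by blast
qed

end
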